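(* Let $n\ge1$, $0\le k\le n$ and $s=\min(k,n-k)$. Assume that the matrices $[B_{i-1}]_{B_i}$ for $i=2,3,\dots,n$ have been computed. Given a column vector $[f]_{B_0}$ with $f\in\mathcal F$, all the weights $\|f_a\|^2$, for $a=0,\dots,s$, can be computed using at most $(2n-1)\binom nk$ operations.
   Context: Let $X$ be the set of words $w_1\dots w_n$ in the alphabet $\{1,2\}$ with exactly $k$ letters $1$ (the word corresponds to the $k$-subset $\{j: w_j=1\}$ of $\{1,\dots,n\}$). The symmetric group $S_n$ acts on $X$ via its action on $k$-subsets. $\mathcal F$ is the space of complex functions on $X$, with $\sigma f=f\circ\sigma^{-1}$ and the inner product for which the delta functions $\delta(x)$, $x\in X$, are orthonormal; $\|\cdot\|$ is the corresponding norm. For $i\le n$, $S_i\subset S_n$ is the subgroup fixing $i+1,\dots,n$; irreducible representations of $S_i$ are indexed by Young diagrams with $i$ boxes in the usual way ($(i)$ is the trivial representation), and $\mathcal F_{i,\lambda}$ is the $\lambda$-isotypic component of $\mathcal F$ as an $S_i$-module. Write $\lambda\nearrow\mu$ if $\mu$ is obtained from $\lambda$ by adding one box. For Young diagrams $\lambda_1,\dots,\lambda_p$ with $\lambda_j$ having $j$ boxes, $\mathcal F_{\lambda_1\dots\lambda_p}=\mathcal F_{1,\lambda_1}\cap\dots\cap\mathcal F_{p,\lambda_p}$. For a word $c_q\dots c_n$ in $\{1,2\}$, $\mathcal F^{c_q\dots c_n}$ is the span of the $\delta(w)$ with $w\in X$, $w_q\dots w_n=c_q\dots c_n$; for $q=n+1$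 (empty word) it is $\mathcal F$. Put $\mathcal F_{\lambda_1\dots\lambda_p}^{c_q\dots c_n}=\mathcal F_{\lambda_1\dots\lambda_p}\cap\mathcal F^{c_q\dots c_n}$ (for $p=0$ this means $\mathcal F^{c_q\dots c_n}$). For $0\le i\le n$, $\mathcal F$ is the orthogonal direct sum of the one-dimensional subspaces $\mathcal F_{\lambda_1\dots\lambda_i}^{c_{i+1}\dots c_n}$, over all words $c_{i+1}\dots c_n$ with exactly $k-r$ letters $1$ for some $0\le r\le k$, and all chains $\lambda_1\nearrow\dots\nearrow\lambda_i$ with $\lambda_i=(i-a,a)$, $0\le a\le\min(r,i-r)$. The $i$-th intermediate basis $B_i$ is obtained by choosing one unit vector in each of these subspaces (it is unique up to scalars). For $i=0$ the unit vectors are taken to be the delta functions, and $B_1$ is normalized so that $B_1=B_0$. $[B]_{B'}$ denotes the change of basis matrix, whose columns are the elements of $B$ written in the basis $B'$, and $[f]_B$ is the coordinate column vector of $f$ in $B$. For $a=0,\dots,s$, $\mathcal F_a=\mathcal F_{n,(n-a,a)}$; one has $\mathcal F=\bigoplus_{a=0}^s\mathcal F_a$ orthogonally, and $f=\sum_{a=0}^s f_a$ with $f_a\in\mathcal F_a$. Computational model: a single complex multiplication and addition counts as one operation (so adding $|z|^2=z\bar z$ to a running sum is one operation; complex conjugation is not counted). Only these algebraic operations are counted; operations involved in storage (for example reordering rows and columns of a matrix) are not counted. *)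

theory Defs
  imports
    Complex_Main
    "HOL-Library.FuncSet"
    "HOL-Library.Function_Algebras"
    "HOL-Combinatorics.Permutations"
begin

section \<open>Words, functions on words, and the action of the symmetric group\<close>

text \<open>
  A word with positions in a finite set \<open>J\<close> of indices is an extensional function on \<open>J\<close>.
  The same type is used for the words of \<open>X\<close>, for their suffixes \<open>c\<^sub>q\<dots>c\<^sub>n\<close> (positions
  \<open>{q..n}\<close>), and for tabloids (position \<open>x\<close> carries the row containing \<open>x\<close>).
\<close>

type_synonym word = "nat \<Rightarrow> nat"
type_synonym vec = "word \<Rightarrow> complex"

definition scale :: "complex \<Rightarrow> vec \<Rightarrow> vec" where
  "scale z f = (\<lambda>w. z * f w)"

global_interpretation cvec: vector_space scale
  by unfold_locales (auto simp: scale_def fun_eq_iff algebra_simps)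

definition delta :: "word \<Rightarrow> vec" where
  "delta w = (\<lambda>v. if v = w then 1 else 0)"

definition words :: "nat \<Rightarrow> nat \<Rightarrow> word set" where
  "words n k = {w \<in> {1..n} \<rightarrow>\<^sub>E {1, 2}. card {j \<in> {1..n}. w j = 1} = k}"

text \<open>The set of positions of a given letter in \<open>word_act \<sigma> w\<close> is the \<open>\<sigma>\<close>-image of that in \<open>w\<close>.\<close>

definition word_act :: "(nat \<Rightarrow> nat) \<Rightarrow> word \<Rightarrow> word" where
  "word_act \<sigma> w = w \<circ> inv \<sigma>"

definition act :: "(nat \<Rightarrow> nat) \<Rightarrow> vec \<Rightarrow> vec" where
  "act \<sigma> f = f \<circ> word_act (inv \<sigma>)"

text \<open>The complex functions on \<open>X\<close>, extended by zero outside \<open>X\<close>.\<close>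

definition fun_space :: "nat \<Rightarrow> nat \<Rightarrow> vec set" where
  "fun_space n k = {f. \<forall>w. w \<notin> words n k \<longrightarrow> f w = 0}"

definition inner_prod :: "nat \<Rightarrow> nat \<Rightarrow> vec \<Rightarrow> vec \<Rightarrow> complex" where
  "inner_prod n k f g = (\<Sum>w\<in>words n k. f w * cnj (g w))"

definition vec_norm :: "nat \<Rightarrow> nat \<Rightarrow> vec \<Rightarrow> real" where
  "vec_norm n k f = sqrt (Re (inner_prod n k f f))"

section \<open>Young diagrams and irreducible representations\<close>

text \<open>A Young diagram is given by its set of boxes \<open>(row, column)\<close>, both counted from 0.\<close>

type_synonym diagram = "(nat \<times> nat) set"

definition young_diagram :: "diagram \<Rightarrow> bool" where
  "young_diagram D \<longleftrightarrow> finite D \<and>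
     (\<forall>r c r' c'. (r, c) \<in> D \<longrightarrow> r' \<le> r \<longrightarrow> c' \<le> c \<longrightarrow> (r', c') \<in> D)"

definition adds_box :: "diagram \<Rightarrow> diagram \<Rightarrow> bool" where
  "adds_box D E \<longleftrightarrow> (\<exists>b. b \<notin> D \<and> E = insert b D)"

definition two_row :: "nat \<Rightarrow> nat \<Rightarrow> diagram" where
  "two_row i a = {0} \<times> {..<i - a} \<union> {1} \<times> {..<a}"

text \<open>
  The irreducible representation of \<open>S\<^sub>i\<close> attached to a Young diagram \<open>D\<close> with \<open>i\<close> boxes is the
  Specht module: the span, inside the functions on the tabloids of shape \<open>D\<close>, of the
  polytabloids of all tableaux \<open>t\<close> of shape \<open>D\<close>. In particular the one-row diagram gives the
  trivial representation.
\<close>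

definition tableau :: "nat \<Rightarrow> diagram \<Rightarrow> (nat \<Rightarrow> nat \<times> nat) \<Rightarrow> bool" where
  "tableau i D t \<longleftrightarrow> bij_betw t {1..i} D"

definition tabloid :: "nat \<Rightarrow> (nat \<Rightarrow> nat \<times> nat) \<Rightarrow> word" where
  "tabloid i t = restrict (fst \<circ> t) {1..i}"

definition column_stabilizer :: "nat \<Rightarrow> (nat \<Rightarrow> nat \<times> nat) \<Rightarrow> (nat \<Rightarrow> nat) set" where
  "column_stabilizer i t =
     {\<sigma>. \<sigma> permutes {1..i} \<and> (\<forall>x\<in>{1..i}. snd (t (\<sigma> x)) = snd (t x))}"

definition polytabloid :: "nat \<Rightarrow> (nat \<Rightarrow> nat \<times> nat) \<Rightarrow> vec" where
  "polytabloid i t =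
     (\<Sum>\<sigma>\<in>column_stabilizer i t. scale (of_int (sign \<sigma>)) (act \<sigma> (delta (tabloid i t))))"

definition specht :: "nat \<Rightarrow> diagram \<Rightarrow> vec set" where
  "specht i D = cvec.span {polytabloid i t | t. tableau i D t}"

text \<open>\<open>S\<^sub>i\<close> is the group of permutations of the naturals fixing everything outside \<open>{1..i}\<close>.\<close>

definition submodule :: "nat \<Rightarrow> vec set \<Rightarrow> bool" where
  "submodule i W \<longleftrightarrow> cvec.subspace W \<and> (\<forall>\<sigma> f. \<sigma> permutes {1..i} \<longrightarrow> f \<in> W \<longrightarrow> act \<sigma> f \<in> W)"

definition module_iso :: "nat \<Rightarrow> vec set \<Rightarrow> vec set \<Rightarrow> bool" where
  "module_iso i V W \<longleftrightarrow> (\<exists>\<phi>. bij_betw \<phi> V W \<and>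
     (\<forall>f\<in>V. \<forall>g\<in>V. \<phi> (f + g) = \<phi> f + \<phi> g) \<and>
     (\<forall>z. \<forall>f\<in>V. \<phi> (scale z f) = scale z (\<phi> f)) \<and>
     (\<forall>\<sigma>. \<sigma> permutes {1..i} \<longrightarrow> (\<forall>f\<in>V. \<phi> (act \<sigma> f) = act \<sigma> (\<phi> f))))"

definition isotypic :: "nat \<Rightarrow> nat \<Rightarrow> nat \<Rightarrow> diagram \<Rightarrow> vec set" where
  "isotypic n k i D =
     cvec.span (\<Union>{W. W \<subseteq> fun_space n k \<and> submodule i W \<and> module_iso i (specht i D) W})"

section \<open>The intermediate bases\<close>

text \<open>The list \<open>L\<close> stands for \<open>\<lambda>\<^sub>1, \<dots>, \<lambda>\<^sub>p\<close>, so \<open>\<lambda>\<^sub>j\<close> is \<open>L ! (j - 1)\<close>.\<close>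

definition chain_space :: "nat \<Rightarrow> nat \<Rightarrow> diagram list \<Rightarrow> vec set" where
  "chain_space n k L =
     {f \<in> fun_space n k. \<forall>j\<in>{1..length L}. f \<in> isotypic n k j (L ! (j - 1))}"

definition suffix_space :: "nat \<Rightarrow> nat \<Rightarrow> nat \<Rightarrow> word \<Rightarrow> vec set" where
  "suffix_space n k q c = cvec.span {delta w | w. w \<in> words n k \<and> restrict w {q..n} = c}"

text \<open>
  The pairs \<open>(\<lambda>\<^sub>1\<dots>\<lambda>\<^sub>i, c\<^sub>i\<^sub>+\<^sub>1\<dots>c\<^sub>n)\<close> indexing the \<open>i\<close>-th basis. The condition \<open>a + r \<le> i\<close> expresses
  \<open>a \<le> i - r\<close> without truncated subtraction; for \<open>i = 0\<close> the chain is empty.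
\<close>

type_synonym index = "diagram list \<times> word"

definition basis_index :: "nat \<Rightarrow> nat \<Rightarrow> nat \<Rightarrow> index set" where
  "basis_index n k i = {(L, c).
     length L = i \<and>
     (\<forall>j\<in>{1..i}. young_diagram (L ! (j - 1)) \<and> card (L ! (j - 1)) = j) \<and>
     (\<forall>j\<in>{1..<i}. adds_box (L ! (j - 1)) (L ! j)) \<and>
     c \<in> {i + 1..n} \<rightarrow>\<^sub>E {1, 2} \<and>
     (\<exists>r a. r \<le> k \<and> card {j \<in> {i + 1..n}. c j = 1} = k - r \<and>
        a \<le> r \<and> a + r \<le> i \<and> (1 \<le> i \<longrightarrow> last L = two_row i a))}"

text \<open>
  \<open>B i\<close> is the \<open>i\<close>-th basis as a family over \<open>basis_index n k i\<close>. The last conjunct is the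
  normalization \<open>B\<^sub>1 = B\<^sub>0\<close> (equality of the two sets of vectors).
\<close>

definition intermediate_bases :: "nat \<Rightarrow> nat \<Rightarrow> (nat \<Rightarrow> index \<Rightarrow> vec) \<Rightarrow> bool" where
  "intermediate_bases n k B \<longleftrightarrow>
     (\<forall>i\<le>n. \<forall>(L, c)\<in>basis_index n k i.
        B i (L, c) \<in> chain_space n k L \<inter> suffix_space n k (i + 1) c \<and>
        vec_norm n k (B i (L, c)) = 1) \<and>
     (\<forall>w\<in>words n k. B 0 ([], w) = delta w) \<and>
     B 1 ` basis_index n k 1 = B 0 ` basis_index n k 0"

definition coord :: "nat \<Rightarrow> nat \<Rightarrow> (nat \<Rightarrow> index \<Rightarrow> vec) \<Rightarrow> nat \<Rightarrow> vec \<Rightarrow> index \<Rightarrow> complex" where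
  "coord n k B i f x = cvec.representation (B i ` basis_index n k i) f (B i x)"

text \<open>The entry of \<open>[B\<^sub>i\<^sub>-\<^sub>1]\<close> in the basis \<open>B\<^sub>i\<close> with row index \<open>x\<close> and column index \<open>y\<close>.\<close>

definition change_entry :: "nat \<Rightarrow> nat \<Rightarrow> (nat \<Rightarrow> index \<Rightarrow> vec) \<Rightarrow> nat \<Rightarrow> index \<Rightarrow> index \<Rightarrow> complex" where
  "change_entry n k B i x y = coord n k B i (B (i - 1) y) x"

text \<open>The component \<open>f\<^sub>a\<close> of \<open>f\<close> in the isotypic component of \<open>(n - a, a)\<close>.\<close>

definition component :: "nat \<Rightarrow> nat \<Rightarrow> vec \<Rightarrow> nat \<Rightarrow> vec" where
  "component n k f = (THE g.
     (\<forall>a\<le>min k (n - k). g a \<in> isotypic n k n (two_row n a)) \<and>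
     (\<forall>a>min k (n - k). g a = 0) \<and>
     f = (\<Sum>a\<le>min k (n - k). g a))"

section \<open>Computational model\<close>

text \<open>
  A program is a list of instructions \<open>(x, y, z)\<close>, each computing \<open>x + y * z\<close> at the cost of one
  operation. Operands are the constants 0 and 1, input values, and results of earlier
  instructions, possibly conjugated; fetching and conjugating operands is free.
\<close>

datatype 'v operand = Zero | One | Input 'v | Result nat | Conj "'v operand"

type_synonym 'v program = "('v operand \<times> 'v operand \<times> 'v operand) list"

fun operand_val :: "('v \<Rightarrow> complex) \<Rightarrow> complex list \<Rightarrow> 'v operand \<Rightarrow> complex" where
  "operand_val env rs Zero = 0"
| "operand_val env rs One = 1"
| "operand_val env rs (Input v) = env v"
| "operand_val env rs (Result j) = (if j < length rs then rs ! j else 0)"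
| "operand_val env rs (Conj x) = cnj (operand_val env rs x)"

fun exec :: "('v \<Rightarrow> complex) \<Rightarrow> complex list \<Rightarrow> 'v program \<Rightarrow> complex list" where
  "exec env rs [] = rs"
| "exec env rs ((x, y, z) # P) =
     exec env (rs @ [operand_val env rs x + operand_val env rs y * operand_val env rs z]) P"

definition result :: "('v \<Rightarrow> complex) \<Rightarrow> 'v program \<Rightarrow> 'v operand \<Rightarrow> complex" where
  "result env P x = operand_val env (exec env [] P) x"

definition operations :: "'v program \<Rightarrow> nat" where
  "operations P = length P"

text \<open>
  The available data: the entries of the matrices \<open>[B\<^sub>i\<^sub>-\<^sub>1]\<close> in the bases \<open>B\<^sub>i\<close> for \<open>2 \<le> i \<le> n\<close>, and
  the coordinates of \<open>f\<close> in \<open>B\<^sub>0\<close>. Names that denote no such datum carry the value 0.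
\<close>

datatype input_name = Matrix_Entry nat index index | Vector_Entry index

fun input_val :: "nat \<Rightarrow> nat \<Rightarrow> (nat \<Rightarrow> index \<Rightarrow> vec) \<Rightarrow> vec \<Rightarrow> input_name \<Rightarrow> complex" where
  "input_val n k B f (Matrix_Entry i x y) =
     (if i \<in> {2..n} \<and> x \<in> basis_index n k i \<and> y \<in> basis_index n k (i - 1)
      then change_entry n k B i x y else 0)"
| "input_val n k B f (Vector_Entry x) =
     (if x \<in> basis_index n k 0 then coord n k B 0 f x else 0)"

end

theory Submission imports Defs begin

text \<open>
  Since the vectors of \<open>B\<^sub>i\<^sub>-\<^sub>1\<close> and \<open>B\<^sub>i\<close> lie in isotypic components of \<open>S\<^sub>1, S\<^sub>2, \<dots>\<close> and in suffix
  spaces, and these are mutually orthogonal, each basis is orthonormal and a vector of \<open>B\<^sub>i\<close> with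
  index \<open>(\<lambda>\<^sub>1\<dots>\<lambda>\<^sub>i, c)\<close> is orthogonal to all vectors of \<open>B\<^sub>i\<^sub>-\<^sub>1\<close> except those with index
  \<open>(\<lambda>\<^sub>1\<dots>\<lambda>\<^sub>i\<^sub>-\<^sub>1, 1c)\<close> and \<open>(\<lambda>\<^sub>1\<dots>\<lambda>\<^sub>i\<^sub>-\<^sub>1, 2c)\<close>. Hence every row of the change of basis matrix has at
  most two nonzero entries and each of the \<open>n - 1\<close> passages costs \<open>2 (n choose k)\<close> operations. In
  \<open>B\<^sub>n\<close> each basis vector lies in one of the components \<open>(n - a, a)\<close>, so summing the squared moduli of
  the coordinates costs \<open>n choose k\<close> more.

  That the orthonormal family \<open>B\<^sub>i\<close> is a basis follows by counting: it has at least \<open>n choose k\<close> members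
  because the indices of \<open>B\<^sub>i\<^sub>-\<^sub>1\<close> inject into those of \<open>B\<^sub>i\<close>.
\<close>

section \<open>Column antisymmetrizers\<close>

lemma sum_fun_apply: "(\<Sum>x\<in>A. F x) w = (\<Sum>x\<in>A. F x w)" for F :: "'c \<Rightarrow> 'd \<Rightarrow> 'e::comm_monoid_add"
  by (induction A rule: infinite_finite_induct) auto

text \<open>The inverses in \<open>act\<close> and \<open>word_act\<close> cancel for a bijection,
  so acting on a function is precomposition of its words with \<open>\<sigma>\<close>. This makes
  \<open>act\<close> a left action.\<close>

lemma act_apply: "bij \<sigma> \<Longrightarrow> act \<sigma> f w = f (w \<circ> \<sigma>)"
  by (simp add: act_def word_act_def inv_inv_eq)

lemma act_compose:
  assumes "bij \<sigma>" "bij \<tau>"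
  shows "act (\<sigma> \<circ> \<tau>) f = act \<sigma> (act \<tau> f)"
  using assms by (auto simp: act_apply bij_comp fun_eq_iff comp_assoc)

lemma act_linear:
  "act \<sigma> (f + g) = act \<sigma> f + act \<sigma> g" "act \<sigma> (scale z f) = scale z (act \<sigma> f)"
  "act \<sigma> 0 = 0"
  by (auto simp: act_def scale_def fun_eq_iff)

lemma act_sum: "act \<sigma> (\<Sum>x\<in>A. F x) = (\<Sum>x\<in>A. act \<sigma> (F x))"
  by (simp add: act_def fun_eq_iff sum_fun_apply)

lemma comp_bij_inv:
  assumes "bij \<sigma>"
  shows "f \<circ> \<sigma> \<circ> inv \<sigma> = f" "f \<circ> inv \<sigma> \<circ> \<sigma> = f"
  using assms by (simp_all add: fun_eq_iff bij_is_inj bij_is_surj surj_f_inv_f inv_f_f)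

lemma bij_inv_comp:
  assumes "bij \<sigma>"
  shows "\<sigma> \<circ> (inv \<sigma> \<circ> f) = f" "inv \<sigma> \<circ> (\<sigma> \<circ> f) = f"
  using assms by (simp_all add: fun_eq_iff bij_is_inj bij_is_surj surj_f_inv_f inv_f_f)

lemma act_delta:
  assumes "bij \<sigma>"
  shows "act \<sigma> (delta u) = delta (u \<circ> inv \<sigma>)"
proof -
  have "v \<circ> \<sigma> = u \<longleftrightarrow> v = u \<circ> inv \<sigma>" for v
    using comp_bij_inv[OF assms, of v] comp_bij_inv[OF assms, of u] by auto
  then show ?thesis
    using assms by (auto simp: fun_eq_iff act_apply delta_def)
qed

section \<open>The column stabilizer as a group, and sums over it\<close>

lemma column_stabilizer_permutes: "\<sigma> \<in> column_stabilizer i t \<Longrightarrow> \<sigma> permutes {1..i}"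
  by (simp add: column_stabilizer_def)

lemma column_stabilizer_bij: "\<sigma> \<in> column_stabilizer i t \<Longrightarrow> bij \<sigma>"
  using column_stabilizer_permutes permutes_bij by blast

lemma column_stabilizer_permutation: "\<sigma> \<in> column_stabilizer i t \<Longrightarrow> permutation \<sigma>"
  using column_stabilizer_permutes permutation_permutes by blast

lemma finite_column_stabilizer: "finite (column_stabilizer i t)"
  by (rule finite_subset[OF _ finite_permutations[of "{1..i}"]])
    (auto simp: column_stabilizer_def)

lemma id_in_column_stabilizer: "id \<in> column_stabilizer i t"
  by (simp add: column_stabilizer_def permutes_id)

lemma column_stabilizer_comp:
  assumes "\<sigma> \<in> column_stabilizer i t" "\<tau> \<in> column_stabilizer i t"
  shows "\<sigma> \<circ> \<tau> \<in> column_stabilizer i t"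
proof -
  have "\<tau> x \<in> {1..i}" if "x \<in> {1..i}" for x
    using assms(2) that permutes_in_image by (fastforce simp: column_stabilizer_def)
  then show ?thesis
    using assms by (simp add: column_stabilizer_def permutes_compose)
qed

lemma column_stabilizer_inv:
  assumes "\<sigma> \<in> column_stabilizer i t"
  shows "inv \<sigma> \<in> column_stabilizer i t"
proof -
  have p: "\<sigma> permutes {1..i}" using assms by (rule column_stabilizer_permutes)
  have "snd (t (inv \<sigma> x)) = snd (t x)" if "x \<in> {1..i}" for x
  proof -
    have "inv \<sigma> x \<in> {1..i}" using that permutes_in_image[OF permutes_inv[OF p]] by blast
    then have "snd (t (\<sigma> (inv \<sigma> x))) = snd (t (inv \<sigma> x))"
      using assms by (simp add: column_stabilizer_def)
    then show ?thesis using permutes_inverses(1)[OF p] by simp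
  qed
  then show ?thesis using permutes_inv[OF p] by (simp add: column_stabilizer_def)
qed

lemma sum_column_stabilizer_right:
  assumes "\<tau> \<in> column_stabilizer i t"
  shows "(\<Sum>\<sigma>\<in>column_stabilizer i t. F (\<sigma> \<circ> \<tau>)) = (\<Sum>\<sigma>\<in>column_stabilizer i t. F \<sigma>)"
proof (rule sum.reindex_bij_witness[where i = "\<lambda>\<sigma>. \<sigma> \<circ> inv \<tau>" and j = "\<lambda>\<sigma>. \<sigma> \<circ> \<tau>"])
  have "bij \<tau>" using assms by (rule column_stabilizer_bij)
  then show "(a \<circ> \<tau>) \<circ> inv \<tau> = a" "(a \<circ> inv \<tau>) \<circ> \<tau> = a" for a :: "nat \<Rightarrow> nat"
    by (simp_all only: comp_bij_inv)
qed (use assms column_stabilizer_comp column_stabilizer_inv in auto)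

lemma sum_column_stabilizer_left:
  assumes "\<tau> \<in> column_stabilizer i t"
  shows "(\<Sum>\<sigma>\<in>column_stabilizer i t. F (\<tau> \<circ> \<sigma>)) = (\<Sum>\<sigma>\<in>column_stabilizer i t. F \<sigma>)"
proof (rule sum.reindex_bij_witness[where i = "\<lambda>\<sigma>. inv \<tau> \<circ> \<sigma>" and j = "\<lambda>\<sigma>. \<tau> \<circ> \<sigma>"])
  have "bij \<tau>" using assms by (rule column_stabilizer_bij)
  then show "inv \<tau> \<circ> (\<tau> \<circ> a) = a" "\<tau> \<circ> (inv \<tau> \<circ> a) = a" for a :: "nat \<Rightarrow> nat"
    by (simp_all only: bij_inv_comp)
qed (use assms column_stabilizer_comp column_stabilizer_inv in auto)

lemma sum_column_stabilizer_inv: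
  "(\<Sum>\<sigma>\<in>column_stabilizer i t. F (inv \<sigma>)) = (\<Sum>\<sigma>\<in>column_stabilizer i t. F \<sigma>)"
  by (rule sum.reindex_bij_witness[where i = inv and j = inv])
    (use column_stabilizer_inv column_stabilizer_bij inv_inv_eq in blast)+

text \<open>Young's signed column sum, taken as an operator on all functions of words, so that the
  same operator acts on functions on tabloids and on functions on \<open>words n k\<close>.\<close>

definition antisymmetrizer :: "nat \<Rightarrow> (nat \<Rightarrow> nat \<times> nat) \<Rightarrow> vec \<Rightarrow> vec" where
  "antisymmetrizer i t f =
     (\<Sum>\<sigma>\<in>column_stabilizer i t. scale (of_int (sign \<sigma>)) (act \<sigma> f))"

lemma polytabloid_antisymmetrizer: "polytabloid i t = antisymmetrizer i t (delta (tabloid i t))"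
  by (simp add: polytabloid_def antisymmetrizer_def)

lemma antisymmetrizer_linear:
  "antisymmetrizer i t (f + g) = antisymmetrizer i t f + antisymmetrizer i t g"
  "antisymmetrizer i t (scale z f) = scale z (antisymmetrizer i t f)"
  "antisymmetrizer i t 0 = 0"
  by (simp_all add: antisymmetrizer_def act_linear cvec.scale_right_distrib sum.distrib
      cvec.scale_sum_right mult.commute)

lemma antisymmetrizer_sum:
  "antisymmetrizer i t (\<Sum>x\<in>A. F x) = (\<Sum>x\<in>A. antisymmetrizer i t (F x))"
  by (simp add: antisymmetrizer_def act_sum cvec.scale_sum_right sum.swap[of _ _ A])

text \<open>Translating the sum by \<open>\<tau>\<close> replaces the sign of
  \<open>\<sigma>\<close> by that of \<open>\<sigma> \<circ> \<tau>\<close>, and the extra sign is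
  its own inverse.\<close>

lemma antisymmetrizer_act:
  assumes "\<tau> \<in> column_stabilizer i t"
  shows "antisymmetrizer i t (act \<tau> f) = scale (of_int (sign \<tau>)) (antisymmetrizer i t f)"
proof -
  have "antisymmetrizer i t (act \<tau> f) = (\<Sum>\<sigma>\<in>column_stabilizer i t.
      scale (of_int (sign \<tau>)) (scale (of_int (sign (\<sigma> \<circ> \<tau>))) (act (\<sigma> \<circ> \<tau>) f)))"
    unfolding antisymmetrizer_def
  proof (rule sum.cong)
    fix \<sigma> assume s: "\<sigma> \<in> column_stabilizer i t"
    have "sign (\<sigma> \<circ> \<tau>) = sign \<sigma> * sign \<tau>"
      using s assms column_stabilizer_permutation sign_compose by blast
    moreover have "act (\<sigma> \<circ> \<tau>) f = act \<sigma> (act \<tau> f)"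
      using s assms column_stabilizer_bij act_compose by blast
    moreover have "(of_int (sign \<tau>) :: complex) * (of_int (sign \<sigma>) * of_int (sign \<tau>)) = of_int (sign \<sigma>)"
      by (simp add: sign_def)
    ultimately show "scale (of_int (sign \<sigma>)) (act \<sigma> (act \<tau> f)) =
        scale (of_int (sign \<tau>)) (scale (of_int (sign (\<sigma> \<circ> \<tau>))) (act (\<sigma> \<circ> \<tau>) f))"
      by simp
  qed simp
  also have "\<dots> = scale (of_int (sign \<tau>)) (antisymmetrizer i t f)"
    unfolding antisymmetrizer_def cvec.scale_sum_right
    by (rule sum_column_stabilizer_right[OF assms])
  finally show ?thesis .
qed

lemma act_antisymmetrizer:
  assumes "\<tau> \<in> column_stabilizer i t"
  shows "act \<tau> (antisymmetrizer i t f) = scale (of_int (sign \<tau>)) (antisymmetrizer i t f)"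
proof -
  have "act \<tau> (antisymmetrizer i t f) = (\<Sum>\<sigma>\<in>column_stabilizer i t.
      scale (of_int (sign \<tau>)) (scale (of_int (sign (\<tau> \<circ> \<sigma>))) (act (\<tau> \<circ> \<sigma>) f)))"
    unfolding antisymmetrizer_def act_sum
  proof (rule sum.cong)
    fix \<sigma> assume s: "\<sigma> \<in> column_stabilizer i t"
    have "sign (\<tau> \<circ> \<sigma>) = sign \<tau> * sign \<sigma>"
      using s assms column_stabilizer_permutation sign_compose by blast
    moreover have "act (\<tau> \<circ> \<sigma>) f = act \<tau> (act \<sigma> f)"
      using s assms column_stabilizer_bij act_compose by blast
    moreover have "(of_int (sign \<tau>) :: complex) * (of_int (sign \<tau>) * of_int (sign \<sigma>)) = of_int (sign \<sigma>)"
      by (simp add: sign_def)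
    ultimately show "act \<tau> (scale (of_int (sign \<sigma>)) (act \<sigma> f)) =
        scale (of_int (sign \<tau>)) (scale (of_int (sign (\<tau> \<circ> \<sigma>))) (act (\<tau> \<circ> \<sigma>) f))"
      by (simp add: act_linear)
  qed simp
  also have "\<dots> = scale (of_int (sign \<tau>)) (antisymmetrizer i t f)"
    unfolding antisymmetrizer_def cvec.scale_sum_right
    by (rule sum_column_stabilizer_left[OF assms])
  finally show ?thesis .
qed

text \<open>The transposition of \<open>x\<close> and \<open>y\<close> is odd, lies in the column
  stabilizer and fixes \<open>u\<close>, so the result equals its own negative.\<close>

lemma antisymmetrizer_delta_eq_0:
  assumes "x \<in> {1..i}" "y \<in> {1..i}" "x \<noteq> y" "snd (t x) = snd (t y)" "u x = u y"
  shows "antisymmetrizer i t (delta u) = 0"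
proof -
  let ?\<tau> = "Transposition.transpose x y"
  have p: "?\<tau> permutes {1..i}" using assms(1,2) by (rule permutes_swap_id)
  have "\<forall>z\<in>{1..i}. snd (t (?\<tau> z)) = snd (t z)"
    using assms(4) by (auto simp: Transposition.transpose_def)
  then have c: "?\<tau> \<in> column_stabilizer i t" using p by (simp add: column_stabilizer_def)
  have "u \<circ> inv ?\<tau> = u" using assms(5) by (auto simp: fun_eq_iff Transposition.transpose_def)
  then have "act ?\<tau> (delta u) = delta u"
    using act_delta[of ?\<tau> u] by simp
  then have "antisymmetrizer i t (delta u) = scale (-1) (antisymmetrizer i t (delta u))"
    using antisymmetrizer_act[OF c, of "delta u"] assms(3) by (simp add: sign_swap_id)
  then show ?thesis by (auto simp: scale_def fun_eq_iff)
qed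

section \<open>Action on polytabloids, and vanishing on Specht modules with a shorter second
  row\<close>

lemma tableau_permute:
  assumes "tableau i D t" "\<sigma> permutes {1..i}"
  shows "tableau i D (t \<circ> inv \<sigma>)"
  using assms permutes_imp_bij[OF permutes_inv[OF assms(2)]] bij_betw_trans
  unfolding tableau_def by blast

lemma tabloid_permute:
  assumes "\<sigma> permutes {1..i}"
  shows "tabloid i (t \<circ> inv \<sigma>) = tabloid i t \<circ> inv \<sigma>"
  using permutes_in_image[OF permutes_inv[OF assms]]
  by (simp add: tabloid_def fun_eq_iff restrict_def)

lemma column_stabilizer_conj:
  assumes "\<sigma> permutes {1..i}" "\<tau> \<in> column_stabilizer i t"
  shows "\<sigma> \<circ> \<tau> \<circ> inv \<sigma> \<in> column_stabilizer i (t \<circ> inv \<sigma>)"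
proof -
  have "inv \<sigma> x \<in> {1..i}" if "x \<in> {1..i}" for x
    using that permutes_in_image[OF permutes_inv[OF assms(1)]] by blast
  then show ?thesis
    using assms permutes_inverses[OF assms(1)]
    by (simp add: column_stabilizer_def permutes_compose permutes_inv)
qed

text \<open>Conjugation by \<open>\<sigma>\<close> preserves signs and carries the column stabilizer
  of \<open>t\<close> onto that of \<open>t \<circ> inv \<sigma>\<close>, so the two signed sums
  match term by term. Hence Specht modules are stable under the group.\<close>

lemma act_polytabloid:
  assumes \<sigma>: "\<sigma> permutes {1..i}"
  shows "act \<sigma> (polytabloid i t) = polytabloid i (t \<circ> inv \<sigma>)"
proof -
  have b: "bij \<sigma>" "bij (inv \<sigma>)" using permutes_bij[OF \<sigma>] permutes_bij[OF permutes_inv[OF \<sigma>]] by simp_all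
  have pm: "permutation \<sigma>" "permutation (inv \<sigma>)"
    using \<sigma> permutes_inv[OF \<sigma>] permutation_permutes by blast+
  have ii: "inv \<sigma> \<circ> \<sigma> = id" "\<sigma> \<circ> inv \<sigma> = id"
    using permutes_inv_o[OF \<sigma>] by auto
  have t': "t \<circ> inv \<sigma> \<circ> inv (inv \<sigma>) = t"
    using b ii by (simp add: inv_inv_eq comp_assoc)
  have "act \<sigma> (polytabloid i t) = (\<Sum>\<tau>\<in>column_stabilizer i t.
      scale (of_int (sign \<tau>)) (act (\<sigma> \<circ> \<tau>) (delta (tabloid i t))))"
    unfolding polytabloid_def act_sum
    by (rule sum.cong) (use b act_compose column_stabilizer_bij in \<open>auto simp: act_linear\<close>)
  also have "\<dots> = (\<Sum>\<tau>\<in>column_stabilizer i (t \<circ> inv \<sigma>).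
      scale (of_int (sign \<tau>)) (act \<tau> (delta (tabloid i (t \<circ> inv \<sigma>)))))"
  proof (rule sum.reindex_bij_witness
      [where j = "\<lambda>\<tau>. \<sigma> \<circ> \<tau> \<circ> inv \<sigma>" and i = "\<lambda>\<tau>. inv \<sigma> \<circ> \<tau> \<circ> \<sigma>"])
    fix \<tau>
    show "inv \<sigma> \<circ> (\<sigma> \<circ> \<tau> \<circ> inv \<sigma>) \<circ> \<sigma> = \<tau>" "\<sigma> \<circ> (inv \<sigma> \<circ> \<tau> \<circ> \<sigma>) \<circ> inv \<sigma> = \<tau>"
      using \<sigma> by (simp_all add: fun_eq_iff permutes_inverses)
  next
    fix \<tau> assume \<tau>: "\<tau> \<in> column_stabilizer i t"
    show "\<sigma> \<circ> \<tau> \<circ> inv \<sigma> \<in> column_stabilizer i (t \<circ> inv \<sigma>)"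
      using \<sigma> \<tau> by (rule column_stabilizer_conj)
    have "sign (\<sigma> \<circ> \<tau> \<circ> inv \<sigma>) = sign \<tau>"
      using pm column_stabilizer_permutation[OF \<tau>] sign_inverse[OF pm(1)]
      by (simp add: sign_compose permutation_compose mult.assoc sign_idempotent mult.left_commute)
    moreover have "act (\<sigma> \<circ> \<tau> \<circ> inv \<sigma>) (delta (tabloid i (t \<circ> inv \<sigma>))) =
        act (\<sigma> \<circ> \<tau>) (act (inv \<sigma>) (delta (tabloid i (t \<circ> inv \<sigma>))))"
      using b column_stabilizer_bij[OF \<tau>] by (simp add: act_compose bij_comp)
    moreover have "act (inv \<sigma>) (delta (tabloid i (t \<circ> inv \<sigma>))) = delta (tabloid i t)"
      using b ii by (simp add: act_delta tabloid_permute[OF \<sigma>] inv_inv_eq comp_assoc)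
    ultimately show "scale (of_int (sign (\<sigma> \<circ> \<tau> \<circ> inv \<sigma>)))
        (act (\<sigma> \<circ> \<tau> \<circ> inv \<sigma>) (delta (tabloid i (t \<circ> inv \<sigma>)))) =
        scale (of_int (sign \<tau>)) (act (\<sigma> \<circ> \<tau>) (delta (tabloid i t)))"
      by simp
  next
    fix \<tau> assume \<tau>: "\<tau> \<in> column_stabilizer i (t \<circ> inv \<sigma>)"
    show "inv \<sigma> \<circ> \<tau> \<circ> \<sigma> \<in> column_stabilizer i t"
      using column_stabilizer_conj[OF permutes_inv[OF \<sigma>] \<tau>] b t' by (simp add: inv_inv_eq)
  qed
  finally show ?thesis by (simp add: polytabloid_def)
qed

lemma polytabloid_in_specht: "tableau i D t \<Longrightarrow> polytabloid i t \<in> specht i D"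
  unfolding specht_def by (rule cvec.span_base) blast

lemma specht_act:
  assumes \<sigma>: "\<sigma> permutes {1..i}" and "v \<in> specht i D"
  shows "act \<sigma> v \<in> specht i D"
  using assms(2) unfolding specht_def
proof (induction rule: cvec.span_induct)
  case base
  then show ?case
    by (rule cvec.subspaceI) (simp_all add: act_linear cvec.span_zero cvec.span_add cvec.span_scale)
next
  case (step v)
  then show ?case
    using act_polytabloid[OF \<sigma>] tableau_permute[OF _ \<sigma>] by (auto intro!: cvec.span_base)
qed

lemma specht_subspace: "cvec.subspace (specht i D)"
  by (simp add: specht_def)

lemma two_row_row1: "{p \<in> two_row i a. fst p \<noteq> 0} = {1} \<times> {..<a}"
  by (auto simp: two_row_def)

text \<open>Pigeonhole: the \<open>a\<close> second-row entries of a tabloid of shape \<open>(i - a, a)\<close> miss one of the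
  \<open>b > a\<close> columns of length two of \<open>t\<close>, whose transposition then fixes the tabloid.\<close>

lemma antisymmetrizer_tabloid_eq_0:
  assumes t: "tableau i (two_row i b) t" and t': "tableau i (two_row i a) t'"
    and ab: "a < b" "2 * b \<le> i"
  shows "antisymmetrizer i t (delta (tabloid i t')) = 0"
proof -
  define Z where "Z = {x \<in> {1..i}. fst (t' x) \<noteq> 0}"
  have "bij_betw t' Z {p \<in> two_row i a. fst p \<noteq> 0}"
  proof (rule bij_betw_subset)
    show "bij_betw t' {1..i} (two_row i a)" using t' by (simp add: tableau_def)
    then have im: "two_row i a = t' ` {1..i}" by (simp add: bij_betw_def)
    show "t' ` Z = {p \<in> two_row i a. fst p \<noteq> 0}" unfolding Z_def im by auto
  qed (auto simp: Z_def)
  then have Z: "card Z = a"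
    unfolding two_row_row1 using bij_betw_same_card[of t' Z] by fastforce
  have "card ((snd \<circ> t) ` Z) < card {..<b}"
    using card_image_le[of Z "snd \<circ> t"] Z ab by (simp add: Z_def)
  then have "\<not> {..<b} \<subseteq> (snd \<circ> t) ` Z"
    using card_mono[of "(snd \<circ> t) ` Z" "{..<b}"] by (auto simp: Z_def)
  then obtain c where c: "c < b" "c \<notin> (snd \<circ> t) ` Z" by auto
  have im: "t ` {1..i} = two_row i b" using t by (simp add: tableau_def bij_betw_def)
  have "(0, c) \<in> t ` {1..i}" "(1, c) \<in> t ` {1..i}"
    using c(1) ab unfolding im by (auto simp: two_row_def)
  then obtain x y where xy: "x \<in> {1..i}" "y \<in> {1..i}" "t x = (0, c)" "t y = (1, c)" by force
  have "x \<notin> Z" "y \<notin> Z" using c(2) xy by (force simp: image_iff)+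
  then show ?thesis
    using xy by (intro antisymmetrizer_delta_eq_0[of x i y]) (auto simp: Z_def tabloid_def)
qed

text \<open>Every term of a polytabloid is a signed delta function at another tabloid of the same
  shape, hence is killed. The kernel is a subspace, so it contains the whole Specht module.\<close>

lemma antisymmetrizer_specht_eq_0:
  assumes t: "tableau i (two_row i b) t" and ab: "a < b" "2 * b \<le> i"
    and "v \<in> specht i (two_row i a)"
  shows "antisymmetrizer i t v = 0"
proof -
  have "cvec.subspace {v. antisymmetrizer i t v = 0}"
    by (rule cvec.subspaceI) (simp_all add: antisymmetrizer_linear)
  moreover have "antisymmetrizer i t (polytabloid i t') = 0" if t': "tableau i (two_row i a) t'" for t'
  proof -
    have "antisymmetrizer i t (act \<sigma> (delta (tabloid i t'))) = 0"
      if "\<sigma> \<in> column_stabilizer i t'" for \<sigma>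
      using antisymmetrizer_tabloid_eq_0[OF t tableau_permute[OF t'] ab, of \<sigma>]
        column_stabilizer_permutes[OF that] column_stabilizer_bij[OF that]
      by (simp add: tabloid_permute act_delta)
    then show ?thesis
      by (simp add: polytabloid_def antisymmetrizer_sum antisymmetrizer_linear)
  qed
  ultimately have "specht i (two_row i a) \<subseteq> {v. antisymmetrizer i t v = 0}"
    unfolding specht_def by (intro cvec.span_minimal) auto
  then show ?thesis using assms(4) by auto
qed

section \<open>Orthogonality of isotypic components\<close>

lemma finite_words: "finite (words n k)"
  by (rule finite_subset[of _ "{1..n} \<rightarrow>\<^sub>E {1, 2}"]) (auto simp: words_def intro: finite_PiE)

text \<open>A word is recovered from the positions of its letter 1, so the count is that of the
  \<open>k\<close>-subsets.\<close>

lemma card_words: "card (words n k) = n choose k"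
proof -
  have "bij_betw (\<lambda>w. {j \<in> {1..n}. w j = 1}) (words n k) {A. A \<subseteq> {1..n} \<and> card A = k}"
  proof (rule bij_betw_byWitness[where f' = "\<lambda>A. \<lambda>j\<in>{1..n}. if j \<in> A then 1 else 2"])
    show "\<forall>w\<in>words n k. (\<lambda>j\<in>{1..n}. if j \<in> {j \<in> {1..n}. w j = 1} then 1 else 2) = w"
    proof
      fix w assume "w \<in> words n k"
      then have w: "w \<in> {1..n} \<rightarrow>\<^sub>E {1, 2}" by (simp add: words_def)
      show "(\<lambda>j\<in>{1..n}. if j \<in> {j \<in> {1..n}. w j = 1} then 1 else 2) = w"
      proof
        fix j
        show "(\<lambda>j\<in>{1..n}. if j \<in> {j \<in> {1..n}. w j = 1} then 1 else 2) j = w j"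
          using PiE_arb[OF w, of j] PiE_mem[OF w, of j] by (auto simp: restrict_def)
      qed
    qed
    show "\<forall>A\<in>{A. A \<subseteq> {1..n} \<and> card A = k}.
        {j \<in> {1..n}. (\<lambda>j\<in>{1..n}. if j \<in> A then 1 else 2) j = (1::nat)} = A"
      by auto
    have "{j \<in> {1..n}. (\<lambda>j\<in>{1..n}. if j \<in> A then 1 else 2) j = (1::nat)} = A"
      if "A \<subseteq> {1..n}" for A
      using that by auto
    then show "(\<lambda>A. \<lambda>j\<in>{1..n}. if j \<in> A then 1 else 2) ` {A. A \<subseteq> {1..n} \<and> card A = k}
        \<subseteq> words n k"
      unfolding words_def by (intro image_subsetI CollectI conjI PiE_I) (simp_all only: mem_Collect_eq restrict_apply simp_thms if_False, simp_all)
    show "(\<lambda>w. {j \<in> {1..n}. w j = 1}) ` words n k \<subseteq> {A. A \<subseteq> {1..n} \<and> card A = k}"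
      unfolding words_def by (rule image_subsetI) (simp add: subset_iff)
  qed
  then show ?thesis
    by (simp add: bij_betw_same_card n_subsets)
qed

lemma words_comp:
  assumes "\<sigma> permutes {1..n}" "w \<in> words n k"
  shows "w \<circ> \<sigma> \<in> words n k"
proof -
  have w: "w \<in> {1..n} \<rightarrow>\<^sub>E {1, 2}" "card {j \<in> {1..n}. w j = 1} = k"
    using assms(2) by (simp_all add: words_def)
  have bb: "bij_betw \<sigma> {j \<in> {1..n}. (w \<circ> \<sigma>) j = 1} {j \<in> {1..n}. w j = 1}"
    using permutes_in_image[OF assms(1)] permutes_in_image[OF permutes_inv[OF assms(1)]]
      permutes_inverses[OF assms(1)]
    by (intro bij_betw_byWitness[where f' = "inv \<sigma>"]) auto
  have "card {j \<in> {1..n}. (w \<circ> \<sigma>) j = 1} = k"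
    using bij_betw_same_card[OF bb] w(2) by (simp only:)
  moreover have "w \<circ> \<sigma> \<in> {1..n} \<rightarrow>\<^sub>E {1, 2}"
  proof (rule PiE_I)
    fix x assume "x \<in> {1..n}"
    then show "(w \<circ> \<sigma>) x \<in> {1, 2}"
      using permutes_in_image[OF assms(1), of x] PiE_mem[OF w(1)] unfolding comp_def by blast
  next
    fix x assume "x \<notin> {1..n}"
    then show "(w \<circ> \<sigma>) x = undefined"
      using permutes_not_in[OF assms(1)] PiE_arb[OF w(1)] by simp
  qed
  ultimately show ?thesis by (simp add: words_def)
qed

lemma fun_space_subspace: "cvec.subspace (fun_space n k)"
  by (rule cvec.subspaceI) (auto simp: fun_space_def scale_def)

lemma delta_in_fun_space: "w \<in> words n k \<Longrightarrow> delta w \<in> fun_space n k"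
  by (auto simp: fun_space_def delta_def)

text \<open>Provides a spanning set indexed by \<open>words n k\<close>, from which independent
  families get the size bound \<open>n choose k\<close>.\<close>

lemma fun_space_eq_span: "fun_space n k = cvec.span (delta ` words n k)"
proof
  show "fun_space n k \<subseteq> cvec.span (delta ` words n k)"
  proof
    fix f assume f: "f \<in> fun_space n k"
    have "f = (\<Sum>w\<in>words n k. scale (f w) (delta w))"
    proof
      fix v
      have "(\<Sum>w\<in>words n k. f w * (if v = w then 1 else 0)) = (if v \<in> words n k then f v else 0)"
        by (simp add: finite_words if_distrib sum.delta' cong: if_cong)
      then show "f v = (\<Sum>w\<in>words n k. scale (f w) (delta w)) v"
        using f by (simp add: sum_fun_apply scale_def delta_def fun_space_def)
    qed
    also have "\<dots> \<in> cvec.span (delta ` words n k)"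
      by (intro cvec.span_sum cvec.span_scale cvec.span_base) auto
    finally show "f \<in> cvec.span (delta ` words n k)" .
  qed
  show "cvec.span (delta ` words n k) \<subseteq> fun_space n k"
    using fun_space_subspace delta_in_fun_space by (intro cvec.span_minimal) auto
qed

lemma inner_prod_linear_left:
  "inner_prod n k (f + g) h = inner_prod n k f h + inner_prod n k g h"
  "inner_prod n k (scale z f) h = z * inner_prod n k f h"
  "inner_prod n k 0 h = 0"
  by (simp_all add: inner_prod_def scale_def algebra_simps sum.distrib sum_distrib_left)

lemma inner_prod_linear_right:
  "inner_prod n k h (f + g) = inner_prod n k h f + inner_prod n k h g"
  "inner_prod n k h (scale z f) = cnj z * inner_prod n k h f"
  "inner_prod n k h 0 = 0"
  by (simp_all add: inner_prod_def scale_def algebra_simps sum.distrib sum_distrib_left)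

lemma inner_prod_sum_left:
  "inner_prod n k (\<Sum>x\<in>A. F x) h = (\<Sum>x\<in>A. inner_prod n k (F x) h)"
  by (simp add: inner_prod_def sum_fun_apply sum_distrib_right sum.swap[of _ _ A])

lemma inner_prod_sum_right:
  "inner_prod n k h (\<Sum>x\<in>A. F x) = (\<Sum>x\<in>A. inner_prod n k h (F x))"
  by (simp add: inner_prod_def sum_fun_apply sum_distrib_left sum.swap[of _ _ A])

lemma inner_prod_commute: "inner_prod n k g f = cnj (inner_prod n k f g)"
  by (simp add: inner_prod_def mult.commute)

text \<open>The inner product of a function with itself is a sum of squared moduli, so taking the
  real part and the root in \<open>vec_norm\<close> loses nothing.\<close>

lemma inner_prod_self: "inner_prod n k f f = complex_of_real ((vec_norm n k f)\<^sup>2)"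
proof -
  have "inner_prod n k f f = complex_of_real (\<Sum>w\<in>words n k. (cmod (f w))\<^sup>2)"
    by (simp only: inner_prod_def of_real_sum complex_norm_square)
  moreover have "(\<Sum>w\<in>words n k. (cmod (f w))\<^sup>2) \<ge> 0" by (simp add: sum_nonneg)
  ultimately show ?thesis by (simp add: vec_norm_def)
qed

lemma inner_prod_self_eq_0:
  assumes "f \<in> fun_space n k" "inner_prod n k f f = 0"
  shows "f = 0"
proof -
  have "complex_of_real (\<Sum>w\<in>words n k. (cmod (f w))\<^sup>2) = 0"
    using assms(2) by (simp only: inner_prod_def of_real_sum complex_norm_square)
  then have "(\<Sum>w\<in>words n k. (cmod (f w))\<^sup>2) = 0" using of_real_eq_0_iff by blast
  then have "\<forall>w\<in>words n k. f w = 0"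
    by (simp add: sum_nonneg_eq_0_iff finite_words)
  then show ?thesis using assms(1) by (auto simp: fun_space_def fun_eq_iff)
qed

lemma inner_prod_act:
  assumes "\<sigma> permutes {1..n}"
  shows "inner_prod n k (act \<sigma> f) g = inner_prod n k f (act (inv \<sigma>) g)"
proof -
  note inv = permutes_inv[OF assms]
  have b: "bij \<sigma>" "bij (inv \<sigma>)" using permutes_bij[OF assms] permutes_bij[OF inv] by simp_all
  have o: "w \<circ> \<sigma> \<circ> inv \<sigma> = w" "w \<circ> inv \<sigma> \<circ> \<sigma> = w" for w :: word
    using permutes_inv_o[OF assms] by (simp_all add: comp_assoc)
  show ?thesis
    unfolding inner_prod_def act_apply[OF b(1)] act_apply[OF b(2)]
    by (rule sum.reindex_bij_witness[where i = "\<lambda>w. w \<circ> inv \<sigma>" and j = "\<lambda>w. w \<circ> \<sigma>"])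
      (simp_all only: o words_comp[OF assms] words_comp[OF inv])
qed

text \<open>Self-adjointness: each permutation acts unitarily, and inversion permutes the column
  stabilizer without changing signs. With \<open>i \<le> n\<close> these permutations map
  \<open>words n k\<close> to itself.\<close>

lemma inner_prod_antisymmetrizer:
  assumes "i \<le> n"
  shows "inner_prod n k (antisymmetrizer i t f) g = inner_prod n k f (antisymmetrizer i t g)"
proof -
  have "inner_prod n k (antisymmetrizer i t f) g = (\<Sum>\<sigma>\<in>column_stabilizer i t.
      of_int (sign (inv \<sigma>)) * inner_prod n k f (act (inv \<sigma>) g))"
    unfolding antisymmetrizer_def inner_prod_sum_left
  proof (rule sum.cong)
    fix \<sigma> assume s: "\<sigma> \<in> column_stabilizer i t"
    have "\<sigma> permutes {1..n}"
      using permutes_subset[OF column_stabilizer_permutes[OF s]] assms by auto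
    then show "inner_prod n k (scale (of_int (sign \<sigma>)) (act \<sigma> f)) g =
        of_int (sign (inv \<sigma>)) * inner_prod n k f (act (inv \<sigma>) g)"
      using sign_inverse[OF column_stabilizer_permutation[OF s]]
      by (simp add: inner_prod_linear_left inner_prod_act)
  qed simp
  also have "\<dots> = (\<Sum>\<sigma>\<in>column_stabilizer i t. of_int (sign \<sigma>) * inner_prod n k f (act \<sigma> g))"
    by (rule sum_column_stabilizer_inv[of "\<lambda>\<sigma>. of_int (sign \<sigma>) * inner_prod n k f (act \<sigma> g)"])
  finally show ?thesis
    by (simp add: antisymmetrizer_def inner_prod_sum_right inner_prod_linear_right)
qed

lemma module_iso_sum:
  assumes V: "cvec.subspace V" and add: "\<forall>f\<in>V. \<forall>g\<in>V. \<phi> (f + g) = \<phi> f + \<phi> g"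
    and sc: "\<forall>z. \<forall>f\<in>V. \<phi> (scale z f) = scale z (\<phi> f)" and "\<forall>x\<in>A. F x \<in> V"
  shows "\<phi> (\<Sum>x\<in>A. F x) = (\<Sum>x\<in>A. \<phi> (F x) :: vec)"
proof -
  \<comment> \<open>Obtained by scaling with 0. It settles the empty sum and also an infinite
    \<open>A\<close>, whose sum is 0 by convention.\<close>
  have 0: "\<phi> 0 = 0"
    using sc[rule_format, of 0 0] cvec.subspace_0[OF V] by simp
  show ?thesis
  proof (cases "finite A")
    define P where "P B \<longleftrightarrow> \<phi> (sum F B) = (\<Sum>x\<in>B. \<phi> (F x))" for B
    case True
    then have "\<forall>x\<in>A. F x \<in> V \<Longrightarrow> P A"
    proof (induction A)
      case (insert x A)
      then show ?case using add cvec.subspace_sum[OF V, of A F] by (simp add: P_def)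
    qed (simp add: 0 P_def)
    then show ?thesis using assms(4) by (simp add: P_def)
  qed (use 0 in simp)
qed

text \<open>Orthogonality without irreducibility or Schur's lemma: the antisymmetrizer of a tableau \<open>t\<close>
  of shape \<open>(i - b, b)\<close> kills \<open>V\<close>, is self-adjoint, and multiplies the image in \<open>W\<close> of the
  polytabloid of \<open>t\<close> by the order of the column stabilizer.\<close>

lemma module_iso_specht_orthogonal:
  assumes V: "module_iso i (specht i (two_row i a)) V"
    and W: "module_iso i (specht i (two_row i b)) W"
    and ab: "a < b" "2 * b \<le> i" "i \<le> n" and "f \<in> V" "g \<in> W"
  shows "inner_prod n k f g = 0"
proof -
  obtain \<phi> where \<phi>: "bij_betw \<phi> (specht i (two_row i a)) V"
    "\<forall>f\<in>specht i (two_row i a). \<forall>g\<in>specht i (two_row i a). \<phi> (f + g) = \<phi> f + \<phi> g"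
    "\<forall>z. \<forall>f\<in>specht i (two_row i a). \<phi> (scale z f) = scale z (\<phi> f)"
    "\<forall>\<sigma>. \<sigma> permutes {1..i} \<longrightarrow> (\<forall>f\<in>specht i (two_row i a). \<phi> (act \<sigma> f) = act \<sigma> (\<phi> f))"
    using V unfolding module_iso_def by blast
  obtain \<psi> where \<psi>: "bij_betw \<psi> (specht i (two_row i b)) W"
    "\<forall>f\<in>specht i (two_row i b). \<forall>g\<in>specht i (two_row i b). \<psi> (f + g) = \<psi> f + \<psi> g"
    "\<forall>z. \<forall>f\<in>specht i (two_row i b). \<psi> (scale z f) = scale z (\<psi> f)"
    "\<forall>\<sigma>. \<sigma> permutes {1..i} \<longrightarrow> (\<forall>f\<in>specht i (two_row i b). \<psi> (act \<sigma> f) = act \<sigma> (\<psi> f))"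
    using W unfolding module_iso_def by blast
  obtain u where u: "u \<in> specht i (two_row i a)" "f = \<phi> u"
    using \<phi>(1) \<open>f \<in> V\<close> by (auto simp: bij_betw_def)
  obtain v where v: "v \<in> specht i (two_row i b)" "g = \<psi> v"
    using \<psi>(1) \<open>g \<in> W\<close> by (auto simp: bij_betw_def)
  have poly: "inner_prod n k f (\<psi> (polytabloid i t)) = 0" if t: "tableau i (two_row i b) t" for t
  proof -
    let ?e = "polytabloid i t" and ?C = "column_stabilizer i t"
    have e: "?e \<in> specht i (two_row i b)" using t by (rule polytabloid_in_specht)
    \<comment> \<open>A polytabloid is itself an antisymmetrized function, so the column stabilizer
      acts on it by signs; equivariance of \<open>\<psi>\<close> transports this to
      \<open>W\<close>.\<close>
    have "act \<sigma> (\<psi> ?e) = scale (of_int (sign \<sigma>)) (\<psi> ?e)" if "\<sigma> \<in> ?C" for \<sigma>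
      using \<psi>(3,4) e column_stabilizer_permutes[OF that] act_antisymmetrizer[OF that]
      by (metis polytabloid_antisymmetrizer)
    then have "antisymmetrizer i t (\<psi> ?e) = (\<Sum>\<sigma>\<in>?C. \<psi> ?e)"
      unfolding antisymmetrizer_def
      by (intro sum.cong) (simp_all flip: of_int_mult add: sign_idempotent)
    moreover have "antisymmetrizer i t f = 0"
    proof -
      have "antisymmetrizer i t f = (\<Sum>\<sigma>\<in>?C. \<phi> (scale (of_int (sign \<sigma>)) (act \<sigma> u)))"
        unfolding antisymmetrizer_def u(2)
        using \<phi>(3,4) u(1) specht_act column_stabilizer_permutes by (intro sum.cong) auto
      also have "\<dots> = \<phi> (antisymmetrizer i t u)"
        unfolding antisymmetrizer_def
        by (rule module_iso_sum[OF specht_subspace \<phi>(2,3), symmetric])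
          (use u(1) specht_act column_stabilizer_permutes specht_subspace cvec.subspace_scale in blast)
      also have "\<dots> = \<phi> (scale 0 0)"
        using antisymmetrizer_specht_eq_0[OF t ab(1,2) u(1)] by simp
      also have "\<dots> = 0"
        using \<phi>(3) cvec.subspace_0[OF specht_subspace] cvec.scale_zero_left by metis
      finally show ?thesis .
    qed
    \<comment> \<open>Self-adjointness moves the antisymmetrizer from \<open>f\<close>, where it
      gives 0, to the image of the polytabloid, where it multiplies by the order of the
      stabilizer.\<close>
    ultimately have "(\<Sum>\<sigma>\<in>?C. inner_prod n k f (\<psi> ?e)) = 0"
      using inner_prod_antisymmetrizer[OF ab(3), of k t f "\<psi> ?e"]
      by (simp add: inner_prod_sum_right inner_prod_linear_left del: sum_constant)
    then have "of_nat (card ?C) * inner_prod n k f (\<psi> ?e) = 0"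
      by simp
    moreover have "card ?C \<noteq> 0"
      using finite_column_stabilizer[of i t] id_in_column_stabilizer[of i t] by auto
    ultimately show ?thesis by simp
  qed
  \<comment> \<open>Membership in the Specht module is carried along in the induction because
    \<open>\<psi>\<close> is known to be linear only there.\<close>
  have "v \<in> specht i (two_row i b) \<and> inner_prod n k f (\<psi> v) = 0"
    using v(1) unfolding specht_def
  proof (rule cvec.span_induct)
    have "cvec.subspace {x \<in> specht i (two_row i b). inner_prod n k f (\<psi> x) = 0}"
    proof (rule cvec.subspaceI)
      have "0 \<in> specht i (two_row i b)" using cvec.subspace_0[OF specht_subspace] .
      moreover have "\<psi> 0 = 0" using \<psi>(3) calculation cvec.scale_zero_left by metis
      ultimately show "0 \<in> {x \<in> specht i (two_row i b). inner_prod n k f (\<psi> x) = 0}"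
        by (simp add: inner_prod_linear_right)
    qed (use \<psi>(2,3) cvec.subspace_add[OF specht_subspace] cvec.subspace_scale[OF specht_subspace]
        in \<open>simp_all add: inner_prod_linear_right\<close>)
    then show "cvec.subspace {x. x \<in> cvec.span {polytabloid i t |t. tableau i (two_row i b) t}
        \<and> inner_prod n k f (\<psi> x) = 0}"
      by (simp add: specht_def)
  qed (use poly cvec.span_base in auto)
  then show ?thesis using v(2) by simp
qed

lemma isotypic_subset_fun_space: "isotypic n k i D \<subseteq> fun_space n k"
  unfolding isotypic_def by (rule cvec.span_minimal[OF _ fun_space_subspace]) auto

lemma isotypic_subspace: "cvec.subspace (isotypic n k i D)"
  by (simp add: isotypic_def)

lemma span_orthogonal:
  assumes "\<And>f g. f \<in> S \<Longrightarrow> g \<in> T \<Longrightarrow> inner_prod n k f g = 0"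
    and "f \<in> cvec.span S" "g \<in> cvec.span T"
  shows "inner_prod n k f g = 0"
proof -
  have 1: "inner_prod n k f g = 0" if "g \<in> T" for g
    using assms(2)
  proof (rule cvec.span_induct)
    show "cvec.subspace {f. inner_prod n k f g = 0}"
      by (rule cvec.subspaceI) (simp_all add: inner_prod_linear_left)
  qed (use assms(1) that in blast)
  show ?thesis using assms(3)
  proof (rule cvec.span_induct)
    show "cvec.subspace {g. inner_prod n k f g = 0}"
      by (rule cvec.subspaceI) (simp_all add: inner_prod_linear_right)
  qed (use 1 in blast)
qed

text \<open>Orthogonality of all pairs of generating submodules passes to their spans. The case
  \<open>a < b\<close> suffices, since conjugate symmetry exchanges the two components.\<close>

lemma isotypic_orthogonal:
  assumes "a \<noteq> b" "2 * a \<le> i" "2 * b \<le> i" "i \<le> n"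
    and "f \<in> isotypic n k i (two_row i a)" "g \<in> isotypic n k i (two_row i b)"
  shows "inner_prod n k f g = 0"
proof -
  have "inner_prod n k f g = 0"
    if "a < b" "2 * b \<le> i" "f \<in> isotypic n k i (two_row i a)" "g \<in> isotypic n k i (two_row i b)"
    for a b f g
    using that(3,4) unfolding isotypic_def
    by (rule span_orthogonal[rotated]) (use module_iso_specht_orthogonal that assms(4) in blast)
  from this[of a b f g] this[of b a g f] assms show ?thesis
    by (metis complex_cnj_zero inner_prod_commute linorder_neqE_nat)
qed

section \<open>Counting the basis indices\<close>

lemma in_two_row: "(r, c) \<in> two_row i a \<longleftrightarrow> r = 0 \<and> c < i - a \<or> r = 1 \<and> c < a"
  by (auto simp: two_row_def)

lemma two_row_inject: "two_row i a = two_row i b \<longleftrightarrow> a = b"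
proof
  assume eq: "two_row i a = two_row i b"
  have "c < a \<longleftrightarrow> c < b" for c
    using in_two_row[of 1 c i a] in_two_row[of 1 c i b] eq by simp
  then show "a = b" by (metis less_irrefl linorder_neqE_nat)
qed simp

lemma finite_two_row: "finite (two_row i a)"
  by (simp add: two_row_def)

lemma card_two_row: "a \<le> i \<Longrightarrow> card (two_row i a) = i"
  unfolding two_row_def by (subst card_Un_disjoint) (auto simp: card_cartesian_product)

lemma young_diagram_two_row: "2 * a \<le> i \<Longrightarrow> young_diagram (two_row i a)"
  by (auto simp: young_diagram_def finite_two_row in_two_row)

lemma adds_box_two_row_row0: "a \<le> i \<Longrightarrow> adds_box (two_row i a) (two_row (Suc i) a)"
  unfolding adds_box_def
  by (rule exI[of _ "(0, i - a)"]) (auto simp: two_row_def Suc_diff_le)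

lemma adds_box_two_row_row1: "adds_box (two_row i a) (two_row (Suc i) (Suc a))"
  unfolding adds_box_def
  by (rule exI[of _ "(1, a)"]) (auto simp: two_row_def)

text \<open>The least number missing from \<open>A\<close> bounds \<open>A\<close> from above, by
  downward closure, and every smaller number belongs to \<open>A\<close>.\<close>

lemma downward_closed_eq_lessThan:
  fixes A :: "nat set"
  assumes "finite A" "\<And>x y. x \<in> A \<Longrightarrow> y \<le> x \<Longrightarrow> y \<in> A"
  shows "A = {..<card A}"
proof -
  define m where "m = (LEAST x. x \<notin> A)"
  obtain x where x: "x \<notin> A" using ex_new_if_finite[OF infinite_UNIV_nat assms(1)] by blast
  have "m \<notin> A" unfolding m_def using x by (rule LeastI)
  moreover have "y \<in> A" if "y < m" for y using that not_less_Least unfolding m_def by blast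
  ultimately have "A = {..<m}" using assms(2) by (metis lessThan_iff not_le set_eqI)
  then show ?thesis by simp
qed

text \<open>Each row of a Young diagram is an initial segment and the second is contained in the
  first; containment in \<open>two_row m b\<close> excludes further rows.\<close>

lemma young_diagram_two_rows:
  assumes D: "young_diagram D" and sub: "D \<subseteq> two_row m b"
  obtains a where "2 * a \<le> card D" "D = two_row (card D) a"
proof -
  define R where "R r = {c. (r, c) \<in> D}" for r
  have fin: "finite D" using D by (simp add: young_diagram_def)
  have R: "R r = {..<card (R r)}" for r
  proof (rule downward_closed_eq_lessThan)
    have "R r \<subseteq> snd ` D" unfolding R_def by force
    then show "finite (R r)" using fin finite_surj by blast
  qed (use D in \<open>auto simp: R_def young_diagram_def\<close>)
  have mem: "(r, c) \<in> D \<longleftrightarrow> c < card (R r)" for r c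
    using R[of r] unfolding R_def by blast
  have D_eq: "D = {0} \<times> {..<card (R 0)} \<union> {1} \<times> {..<card (R 1)}"
  proof (rule set_eqI)
    fix p :: "nat \<times> nat"
    obtain r c where p: "p = (r, c)" by (cases p)
    have "p \<in> D \<Longrightarrow> r = 0 \<or> r = 1" using sub in_two_row p by auto
    then show "p \<in> D \<longleftrightarrow> p \<in> {0} \<times> {..<card (R 0)} \<union> {1} \<times> {..<card (R 1)}"
      using mem p by auto
  qed
  have card: "card D = card (R 0) + card (R 1)"
    by (subst D_eq, subst card_Un_disjoint) (auto simp: card_cartesian_product)
  have "c \<in> R 0" if "c \<in> R 1" for c
    using D that unfolding young_diagram_def R_def by (metis mem_Collect_eq order_refl zero_le)
  moreover have "finite (R 0)" using R[of 0] by (metis finite_lessThan)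
  ultimately have "card (R 1) \<le> card (R 0)" by (intro card_mono) auto
  with card have "2 * card (R 1) \<le> card D" by simp
  moreover have "D = two_row (card D) (card (R 1))"
    using D_eq card by (simp add: two_row_def)
  ultimately show ?thesis using that by blast
qed

text \<open>The chain increases to a two-row diagram, so all its members lie inside that diagram.
  Hence the orthogonality of two-row components covers every isotypic component met in a
  chain.\<close>

lemma basis_index_two_row:
  assumes "(L, c) \<in> basis_index n k i" "j \<in> {1..i}"
  obtains a where "2 * a \<le> j" "L ! (j - 1) = two_row j a"
proof -
  have L: "length L = i" "\<And>j. j \<in> {1..<i} \<Longrightarrow> adds_box (L ! (j - 1)) (L ! j)"
    "young_diagram (L ! (j - 1))" "card (L ! (j - 1)) = j"
    using assms by (simp_all add: basis_index_def)
  obtain m b where last: "last L = two_row m b"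
    using assms by (auto simp: basis_index_def)
  have "L ! (j - 1) \<subseteq> L ! (j' - 1)" if "j \<le> j'" "j' \<le> i" for j'
    using that
  proof (induction j' rule: dec_induct)
    case (step m)
    then have "adds_box (L ! (m - 1)) (L ! m)" using L(2)[of m] assms(2) by auto
    then show ?case using step by (auto simp: adds_box_def)
  qed simp
  moreover have "last L = L ! (i - 1)" using L(1) assms(2) by (subst last_conv_nth) auto
  ultimately have "L ! (j - 1) \<subseteq> two_row m b" using assms(2) last by auto
  then show ?thesis using young_diagram_two_rows[OF L(3)] L(4) that by metis
qed

lemma card_ones_Suc:
  assumes "Suc i \<le> n"
  shows "card {j \<in> {i + 1..n}. c j = 1} =
    (if c (i + 1) = (1::nat) then 1 else 0) + card {j \<in> {i + 2..n}. c j = 1}"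
proof -
  have "{j \<in> {i + 1..n}. c j = 1} =
      (if c (i + 1) = 1 then {i + 1} else {}) \<union> {j \<in> {i + 2..n}. c j = 1}"
    using assms by (auto simp: not_less_eq_eq le_Suc_eq dest!: le_neq_implies_less)
  then show ?thesis by (simp add: card_Un_disjoint)
qed

text \<open>Removing the first letter of the suffix, the second row of the diagram grows exactly when that
  letter is 1 and \<open>a + r < i\<close>. Given the new index, the letter is recovered from \<open>a\<close> and the new \<open>r\<close>:
  if both letters led to the same index, then \<open>a + r = i\<close> for the letter 1, and the letter 2 would
  need \<open>a + (r + 1) \<le> i\<close>.\<close>

lemma basis_index_extend:
  assumes Lc: "(L, c) \<in> basis_index n k i" and i: "Suc i \<le> n"
    and r: "r \<le> k" "card {j \<in> {i + 1..n}. c j = 1} = k - r"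
    and a: "a \<le> r" "a + r \<le> i" "1 \<le> i \<longrightarrow> last L = two_row i a"
  defines "a' \<equiv> if c (i + 1) = 1 \<and> a + r < i then Suc a else a"
  shows "(L @ [two_row (Suc i) a'], restrict c {i + 2..n}) \<in> basis_index n k (Suc i)"
proof -
  let ?L = "L @ [two_row (Suc i) a']" and ?c = "restrict c {i + 2..n}"
  have len: "length L = i" and yd: "\<forall>j\<in>{1..i}. young_diagram (L ! (j - 1)) \<and> card (L ! (j - 1)) = j"
    and ab: "\<forall>j\<in>{1..<i}. adds_box (L ! (j - 1)) (L ! j)"
    and c: "c \<in> {i + 1..n} \<rightarrow>\<^sub>E {1, 2}"
    using Lc by (simp_all add: basis_index_def)
  \<comment> \<open>When the second row grows, \<open>2 * a \<le> a + r < i\<close> leaves room for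
    both new units in \<open>Suc i\<close>.\<close>
  have a': "2 * a' \<le> Suc i" "a' \<le> Suc i" using a by (auto simp: a'_def)
  have yd': "\<forall>j\<in>{1..Suc i}. young_diagram (?L ! (j - 1)) \<and> card (?L ! (j - 1)) = j"
  proof
    fix j assume j: "j \<in> {1..Suc i}"
    show "young_diagram (?L ! (j - 1)) \<and> card (?L ! (j - 1)) = j"
    proof (cases "j = Suc i")
      case True
      then show ?thesis
        using a' len by (simp add: nth_append young_diagram_two_row card_two_row)
    next
      case False
      then show ?thesis using j yd len by (auto simp: nth_append)
    qed
  qed
  have ab': "\<forall>j\<in>{1..<Suc i}. adds_box (?L ! (j - 1)) (?L ! j)"
  proof
    fix j assume j: "j \<in> {1..<Suc i}"
    show "adds_box (?L ! (j - 1)) (?L ! j)"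
    proof (cases "j = i")
      case True
      then have "L ! (j - 1) = two_row i a" using a(3) len j last_conv_nth[of L] by fastforce
      moreover have "adds_box (two_row i a) (two_row (Suc i) a')"
        using a(2) by (simp add: a'_def adds_box_two_row_row0 adds_box_two_row_row1)
      ultimately show ?thesis using True j len by (simp add: nth_append)
    next
      case False
      then show ?thesis using j ab len by (auto simp: nth_append)
    qed
  qed
  have c': "?c \<in> {i + 2..n} \<rightarrow>\<^sub>E {1, 2}"
    using c by (auto simp: PiE_iff)
  define r' where "r' = (if c (i + 1) = 1 then Suc r else r)"
  have ones: "card {j \<in> {i + 2..n}. ?c j = 1} = card {j \<in> {i + 2..n}. c j = 1}"
    by (rule arg_cong[where f = card]) auto
  have "r' \<le> k" "card {j \<in> {i + 2..n}. ?c j = 1} = k - r'"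
    using r card_ones_Suc[OF i, of c] unfolding ones by (auto simp: r'_def)
  moreover have "a' \<le> r'" "a' + r' \<le> Suc i" using a by (auto simp: a'_def r'_def)
  ultimately show ?thesis
    using len yd' ab' c' unfolding basis_index_def by auto
qed

text \<open>Counts by an injective extension of indices. The extension is a relation because
  \<open>r\<close> and \<open>a\<close> are only existentially given; injectivity of the relation is
  all that the count uses.\<close>

lemma card_basis_index_Suc:
  assumes fin: "finite (basis_index n k (Suc i))" and i: "Suc i \<le> n"
  shows "card (basis_index n k i) \<le> card (basis_index n k (Suc i))"
proof -
  define ext :: "index \<Rightarrow> index \<Rightarrow> bool" where "ext = (\<lambda>(L, c) y. \<exists>r a. r \<le> k \<and> card {j \<in> {i + 1..n}. c j = 1} = k - r \<and>
     a \<le> r \<and> a + r \<le> i \<and> (1 \<le> i \<longrightarrow> last L = two_row i a) \<and>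
     y = (L @ [two_row (Suc i) (if c (i + 1) = 1 \<and> a + r < i then Suc a else a)],
          restrict c {i + 2..n}))"
  show ?thesis
  proof (rule card_le_if_inj_on_rel[OF fin, where r = ext])
    fix x assume x: "x \<in> basis_index n k i"
    obtain L c where xx: "x = (L, c)" by (cases x)
    obtain r a where ra: "r \<le> k" "card {j \<in> {i + 1..n}. c j = 1} = k - r"
      "a \<le> r" "a + r \<le> i" "1 \<le> i \<longrightarrow> last L = two_row i a"
      using x xx unfolding basis_index_def by auto
    let ?y = "(L @ [two_row (Suc i) (if c (i + 1) = 1 \<and> a + r < i then Suc a else a)],
          restrict c {i + 2..n})"
    have "?y \<in> basis_index n k (Suc i)"
      using basis_index_extend[OF _ i ra] x unfolding xx .
    moreover have "ext x ?y" using ra unfolding ext_def xx prod.case by blast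
    ultimately show "\<exists>y. y \<in> basis_index n k (Suc i) \<and> ext x y" by blast
  next
    fix x x' y assume x: "x \<in> basis_index n k i" "x' \<in> basis_index n k i" and e: "ext x y" "ext x' y"
    obtain L c L' c' where xx: "x = (L, c)" "x' = (L', c')" by (cases x, cases x')
    obtain r a where ra: "r \<le> k" "card {j \<in> {i + 1..n}. c j = 1} = k - r"
      "a \<le> r" "a + r \<le> i" "1 \<le> i \<longrightarrow> last L = two_row i a"
      "y = (L @ [two_row (Suc i) (if c (i + 1) = 1 \<and> a + r < i then Suc a else a)],
          restrict c {i + 2..n})"
      using e(1) unfolding ext_def xx by auto
    obtain r' a' where ra': "r' \<le> k" "card {j \<in> {i + 1..n}. c' j = 1} = k - r'"
      "a' \<le> r'" "a' + r' \<le> i" "1 \<le> i \<longrightarrow> last L' = two_row i a'"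
      "y = (L' @ [two_row (Suc i) (if c' (i + 1) = 1 \<and> a' + r' < i then Suc a' else a')],
          restrict c' {i + 2..n})"
      using e(2) unfolding ext_def xx by auto
    have L: "L = L'" and rc: "restrict c {i + 2..n} = restrict c' {i + 2..n}"
      and b: "(if c (i + 1) = 1 \<and> a + r < i then Suc a else a) =
        (if c' (i + 1) = 1 \<and> a' + r' < i then Suc a' else a')"
      using ra(6) ra'(6) by (simp_all add: two_row_inject)
    \<comment> \<open>The second row is read off the common last diagram. For \<open>i = 0\<close>
      the chain is empty, and \<open>a + r \<le> i\<close> forces 0.\<close>
    have aa: "a = a'"
    proof (cases "1 \<le> i")
      case True
      then show ?thesis using ra(5) ra'(5) L two_row_inject by metis
    qed (use ra ra' in auto)
    have cc: "c \<in> {i + 1..n} \<rightarrow>\<^sub>E {1, 2}" "c' \<in> {i + 1..n} \<rightarrow>\<^sub>E {1, 2}"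
      using x unfolding xx by (simp_all add: basis_index_def)
    have c12: "c (i + 1) \<in> {1, 2}" "c' (i + 1) \<in> {1, 2}"
      using cc[THEN PiE_mem, of "i + 1"] i by auto
    have tail: "c j = c' j" if "j \<in> {i + 2..n}" for j
      using fun_cong[OF rc, of j] that by simp
    then have "{j \<in> {i + 2..n}. c j = 1} = {j \<in> {i + 2..n}. c' j = 1}" by auto
    then have s: "card {j \<in> {i + 2..n}. c j = 1} = card {j \<in> {i + 2..n}. c' j = 1}" by simp
    have "c (i + 1) = c' (i + 1)"
    proof (rule ccontr)
      assume neq: "c (i + 1) \<noteq> c' (i + 1)"
      have m: "k - r = (if c (i + 1) = 1 then 1 else 0) + card {j \<in> {i + 2..n}. c j = 1}"
        using card_ones_Suc[OF i, of c] ra(2) by (simp only:)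
      have m': "k - r' = (if c' (i + 1) = 1 then 1 else 0) + card {j \<in> {i + 2..n}. c j = 1}"
        using card_ones_Suc[OF i, of c'] ra'(2) unfolding s by (simp only:)
      consider "c (i + 1) = 1" "c' (i + 1) = 2" | "c (i + 1) = 2" "c' (i + 1) = 1"
        using neq c12 by auto
      then show False
      proof cases
        case 1
        then have "r' = Suc r" using m m' ra(1) ra'(1) by simp
        moreover have "\<not> a + r < i" using b 1 aa by (simp split: if_splits)
        ultimately show False using ra'(4) aa by simp
      next
        case 2
        then have "r = Suc r'" using m m' ra(1) ra'(1) by simp
        moreover have "\<not> a' + r' < i" using b 2 aa by (simp split: if_splits)
        ultimately show False using ra(4) aa by simp
      qed
    qed
    with tail have "c j = c' j" if "j \<in> {i + 1..n}" for j
      using that by (cases "j = i + 1") auto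
    then have "c = c'" using cc by (intro PiE_ext)
    with L show "x = x'" by (simp add: xx)
  qed
qed

section \<open>The initial indices, and supports determined by suffixes\<close>

lemma basis_index_0: "basis_index n k 0 = Pair [] ` words n k"
proof -
  have "(L, c) \<in> basis_index n k 0 \<longleftrightarrow> L = [] \<and> c \<in> words n k" for L c
    by (auto simp: basis_index_def words_def)
  then show ?thesis by (auto simp: image_iff)
qed

lemma card_basis_index_0: "card (basis_index n k 0) = n choose k"
  by (simp add: basis_index_0 card_image inj_on_def card_words)

text \<open>The support condition is linear and holds for the generators. It reduces orthogonality
  for different suffixes to disjointness of supports.\<close>

lemma suffix_space_support:
  assumes "f \<in> suffix_space n k q c" "f w \<noteq> 0"
  shows "w \<in> words n k" "restrict w {q..n} = c"
proof -
  have "suffix_space n k q c \<subseteq> {f. \<forall>w. f w \<noteq> 0 \<longrightarrow> w \<in> words n k \<and> restrict w {q..n} = c}"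
    unfolding suffix_space_def
  proof (rule cvec.span_minimal)
    show "cvec.subspace {f. \<forall>w. f w \<noteq> 0 \<longrightarrow> w \<in> words n k \<and> restrict w {q..n} = c}"
    proof (rule cvec.subspaceI)
      fix f g :: vec
      assume *: "f \<in> {f. \<forall>w. f w \<noteq> 0 \<longrightarrow> w \<in> words n k \<and> restrict w {q..n} = c}"
        "g \<in> {f. \<forall>w. f w \<noteq> 0 \<longrightarrow> w \<in> words n k \<and> restrict w {q..n} = c}"
      have "(f + g) w \<noteq> 0 \<Longrightarrow> f w \<noteq> 0 \<or> g w \<noteq> 0" for w by auto
      with * show "f + g \<in> {f. \<forall>w. f w \<noteq> 0 \<longrightarrow> w \<in> words n k \<and> restrict w {q..n} = c}"
        by blast
    qed (auto simp: scale_def)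
  qed (auto simp: delta_def split: if_splits)
  then show "w \<in> words n k" "restrict w {q..n} = c" using assms by blast+
qed

text \<open>The total number of letters 1 is fixed, so the tail of a word determines its first
  letter.\<close>

lemma words_eqI:
  assumes "w \<in> words n k" "w' \<in> words n k" "restrict w {2..n} = restrict w' {2..n}"
  shows "w = w'"
proof -
  have w: "w \<in> {1..n} \<rightarrow>\<^sub>E {1, 2}" "w' \<in> {1..n} \<rightarrow>\<^sub>E {1, 2}"
    and c: "card {j \<in> {1..n}. w j = 1} = k" "card {j \<in> {1..n}. w' j = 1} = k"
    using assms(1,2) by (simp_all add: words_def)
  have tail: "w j = w' j" if "j \<in> {2..n}" for j
    using fun_cong[OF assms(3), of j] that by simp
  then have "{j \<in> {2..n}. w j = 1} = {j \<in> {2..n}. w' j = 1}" by auto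
  then have s: "card {j \<in> {2..n}. w j = 1} = card {j \<in> {2..n}. w' j = 1}" by simp
  have "w j = w' j" if j: "j \<in> {1..n}" for j
  proof (cases "j = 1")
    case True
    have "w 1 \<in> {1, 2}" "w' 1 \<in> {1, 2}" using w[THEN PiE_mem, OF j] True by simp_all
    moreover have "1 \<le> n" using j by simp
    then have "(if w 1 = 1 then 1 else 0) + card {j \<in> {2..n}. w j = 1} =
        (if w' 1 = 1 then 1 else 0) + card {j \<in> {2..n}. w' j = 1}"
      using c card_ones_Suc[of 0 n w] card_ones_Suc[of 0 n w'] by (simp only: add_0 One_nat_def)
    then have "(if w 1 = 1 then 1 else 0) = (if w' 1 = 1 then 1 else (0::nat))"
      unfolding s by (rule add_right_imp_eq)
    then have "w 1 = 1 \<longleftrightarrow> w' 1 = 1" by presburger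
    ultimately show ?thesis unfolding True by auto
  qed (use j tail in auto)
  then show ?thesis using w by (intro PiE_ext)
qed

lemma inner_prod_nonzero_support:
  assumes "inner_prod n k f g \<noteq> 0"
  obtains w where "f w \<noteq> 0" "g w \<noteq> 0"
proof (rule ccontr)
  assume "\<not> thesis"
  then have 0: "f w * cnj (g w) = 0" for w using that by auto
  show False using assms unfolding inner_prod_def 0 by simp
qed

section \<open>Orthonormality and sparsity of the change of basis\<close>

text \<open>Chains differing at step \<open>j\<close> lie in different isotypic components for the
  same subgroup. The lengths \<open>i\<close> and \<open>i'\<close> are independent, so this applies
  within one basis and between consecutive ones.\<close>

lemma chain_space_orthogonal:
  assumes "(L, c) \<in> basis_index n k i" "(L', c') \<in> basis_index n k i'" "i \<le> n"
    and "j \<in> {1..i}" "j \<in> {1..i'}" "L ! (j - 1) \<noteq> L' ! (j - 1)"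
    and "f \<in> chain_space n k L" "g \<in> chain_space n k L'"
  shows "inner_prod n k f g = 0"
proof -
  obtain a where a: "2 * a \<le> j" "L ! (j - 1) = two_row j a"
    using basis_index_two_row[OF assms(1,4)] .
  obtain b where b: "2 * b \<le> j" "L' ! (j - 1) = two_row j b"
    using basis_index_two_row[OF assms(2,5)] .
  have "length L = i" "length L' = i'" using assms(1,2) by (simp_all add: basis_index_def)
  then have "f \<in> isotypic n k j (two_row j a)" "g \<in> isotypic n k j (two_row j b)"
    using assms(4,5,7,8) a(2)[symmetric] b(2)[symmetric] by (simp_all add: chain_space_def)
  then show ?thesis
    using isotypic_orthogonal[of a b j n f k g] a b assms(3,4,6) by auto
qed

text \<open>Fixes one choice of the unit vectors. The operation count later instantiates it at every
  admissible choice.\<close>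

locale basis_family =
  fixes n k :: nat and B :: "nat \<Rightarrow> index \<Rightarrow> vec"
  assumes n_pos: "1 \<le> n" and k_le: "k \<le> n" and bases: "intermediate_bases n k B"
begin

lemma basis_vector:
  assumes "(L, c) \<in> basis_index n k i" "i \<le> n"
  shows "B i (L, c) \<in> chain_space n k L" "B i (L, c) \<in> suffix_space n k (i + 1) c"
    "inner_prod n k (B i (L, c)) (B i (L, c)) = 1"
  using bases assms unfolding intermediate_bases_def inner_prod_self by fastforce+

lemma basis_vector_in_fun_space:
  assumes "x \<in> basis_index n k i" "i \<le> n"
  shows "B i x \<in> fun_space n k"
  using basis_vector(1)[of "fst x" "snd x"] assms by (simp add: chain_space_def)

text \<open>Different suffixes give disjoint supports. With equal suffixes the chains differ at some
  step and the isotypic components separate the vectors.\<close>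

lemma basis_orthonormal:
  assumes x: "x \<in> basis_index n k i" and y: "y \<in> basis_index n k i" and i: "i \<le> n"
  shows "inner_prod n k (B i x) (B i y) = (if x = y then 1 else 0)"
proof (cases "x = y")
  case True
  then show ?thesis using basis_vector(3)[of "fst x" "snd x"] x i by simp
next
  case False
  obtain L c L' c' where xy: "x = (L, c)" "y = (L', c')" by (cases x, cases y)
  have len: "length L = i" "length L' = i" using x y xy by (simp_all add: basis_index_def)
  show ?thesis
  proof (cases "c = c'")
    case True
    then have "L \<noteq> L'" using False xy by simp
    then obtain m where m: "m < i" "L ! m \<noteq> L' ! m" using len by (metis nth_equalityI)
    have "inner_prod n k (B i x) (B i y) = 0"
      using chain_space_orthogonal[of L c n k i L' c' i "Suc m" "B i x" "B i y"] x y xy i m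
        basis_vector(1)[of L c i] basis_vector(1)[of L' c' i] by auto
    then show ?thesis using False by simp
  next
    case neq: False
    have "inner_prod n k (B i x) (B i y) = 0"
    proof (rule ccontr)
      assume "inner_prod n k (B i x) (B i y) \<noteq> 0"
      then obtain w where "B i x w \<noteq> 0" "B i y w \<noteq> 0" by (rule inner_prod_nonzero_support)
      then show False
        using suffix_space_support(2) basis_vector(2) x y xy i neq by metis
    qed
    then show ?thesis using False by simp
  qed
qed

lemma basis_inj:
  assumes i: "i \<le> n"
  shows "inj_on (B i) (basis_index n k i)"
proof (rule inj_onI)
  fix x y assume "x \<in> basis_index n k i" "y \<in> basis_index n k i" "B i x = B i y"
  then show "x = y"
    using basis_orthonormal[of x i y] basis_orthonormal[of y i y] i by (simp split: if_splits)
qed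

lemma basis_independent:
  assumes i: "i \<le> n"
  shows "cvec.independent (B i ` basis_index n k i)"
  unfolding cvec.independent_explicit_finite_subsets
proof (intro allI impI ballI)
  fix S u v
  assume S: "S \<subseteq> B i ` basis_index n k i" "finite S" and 0: "(\<Sum>v\<in>S. scale (u v) v) = 0" and v: "v \<in> S"
  have "inner_prod n k w v = (if w = v then 1 else 0)" if "w \<in> S" for w
  proof -
    obtain x y where "x \<in> basis_index n k i" "y \<in> basis_index n k i" "w = B i x" "v = B i y"
      using \<open>w \<in> S\<close> v S(1) by blast
    then show ?thesis
      using basis_orthonormal[of x i y] i inj_on_eq_iff[OF basis_inj[OF i]] by simp
  qed
  then have "(\<Sum>w\<in>S. u w * inner_prod n k w v) = (\<Sum>w\<in>S. if w = v then u w else 0)"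
    by (intro sum.cong) auto
  also have "\<dots> = u v" using S(2) v by simp
  finally have "u v = inner_prod n k (\<Sum>v\<in>S. scale (u v) v) v"
    by (simp add: inner_prod_sum_left inner_prod_linear_left)
  then show "u v = 0" unfolding 0 inner_prod_linear_left(3) .
qed

lemma independent_card_le:
  assumes "cvec.independent S" "S \<subseteq> fun_space n k"
  shows "finite S" "card S \<le> n choose k"
proof -
  have "finite S \<and> card S \<le> card (delta ` words n k)"
    by (rule cvec.independent_span_bound)
      (use assms in \<open>simp_all add: finite_words flip: fun_space_eq_span\<close>)
  moreover have "card (delta ` words n k) \<le> n choose k"
    using card_image_le[OF finite_words] by (simp add: card_words)
  ultimately show "finite S" "card S \<le> n choose k" by auto
qed

text \<open>Finiteness is inherited from the independent family of vectors, since the indices inject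
  into it; no enumeration of chains is made.\<close>

lemma finite_basis_index: "i \<le> n \<Longrightarrow> finite (basis_index n k i)"
  using independent_card_le(1)[OF basis_independent] basis_inj basis_vector_in_fun_space
  by (metis finite_imageD image_subsetI)

lemma card_basis: "i \<le> n \<Longrightarrow> card (B i ` basis_index n k i) = card (basis_index n k i)"
  by (rule card_image[OF basis_inj])

text \<open>Independence bounds the count from above; the injections between consecutive index sets,
  starting from the words at \<open>i = 0\<close>, bound it from below.\<close>

lemma card_basis_index:
  assumes "i \<le> n"
  shows "card (basis_index n k i) = n choose k"
proof (rule antisym)
  show "card (basis_index n k i) \<le> n choose k"
    using independent_card_le(2)[OF basis_independent[OF assms]] basis_vector_in_fun_space assms
    by (simp add: card_basis image_subset_iff)
  show "n choose k \<le> card (basis_index n k i)"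
    using assms
  proof (induction i)
    case (Suc i)
    then show ?case using card_basis_index_Suc[OF finite_basis_index, of i] by simp
  qed (simp add: card_basis_index_0)
qed

text \<open>A vector outside the span would enlarge the family to \<open>n choose k + 1\<close>
  independent vectors.\<close>

lemma basis_span:
  assumes i: "i \<le> n" and f: "f \<in> fun_space n k"
  shows "f \<in> cvec.span (B i ` basis_index n k i)"
proof (rule ccontr)
  let ?S = "B i ` basis_index n k i"
  assume nf: "f \<notin> cvec.span ?S"
  have "cvec.independent (insert f ?S)"
    using nf basis_independent[OF i] by (rule cvec.independent_insertI)
  moreover have "insert f ?S \<subseteq> fun_space n k" using f basis_vector_in_fun_space[OF _ i] by auto
  ultimately have "card (insert f ?S) \<le> n choose k" by (rule independent_card_le(2))
  moreover have "f \<notin> ?S" using nf cvec.span_base by blast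
  ultimately show False
    using i finite_basis_index[OF i] by (simp add: card_basis card_basis_index)
qed

lemma basis_representation:
  assumes i: "i \<le> n" and f: "f \<in> fun_space n k"
  shows "(\<Sum>x\<in>basis_index n k i. scale (coord n k B i f x) (B i x)) = f"
proof -
  let ?S = "B i ` basis_index n k i"
  have "(\<Sum>b\<in>?S. scale (cvec.representation ?S f b) b) = f"
    by (rule cvec.sum_representation_eq)
      (use i f in \<open>simp_all add: basis_independent basis_span finite_basis_index\<close>)
  then show ?thesis using basis_inj[OF i] by (simp add: sum.reindex coord_def)
qed

text \<open>Orthonormality turns coordinates into inner products, so vanishing matrix entries can be
  read off from orthogonality.\<close>

lemma coord_eq_inner_prod:
  assumes i: "i \<le> n" and f: "f \<in> fun_space n k" and x: "x \<in> basis_index n k i"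
  shows "coord n k B i f x = inner_prod n k f (B i x)"
proof -
  have "inner_prod n k f (B i x) =
      inner_prod n k (\<Sum>y\<in>basis_index n k i. scale (coord n k B i f y) (B i y)) (B i x)"
    by (simp only: basis_representation[OF i f])
  also have "\<dots> = (\<Sum>y\<in>basis_index n k i. coord n k B i f y * inner_prod n k (B i y) (B i x))"
    by (simp add: inner_prod_sum_left inner_prod_linear_left)
  also have "\<dots> = (\<Sum>y\<in>basis_index n k i. if y = x then coord n k B i f y else 0)"
    using basis_orthonormal[OF _ x i] by (intro sum.cong) auto
  also have "\<dots> = coord n k B i f x" using x finite_basis_index[OF i] by simp
  finally show ?thesis by simp
qed

text \<open>A nonzero product forces the first \<open>i\<close> diagrams to agree and the supports
  to share a word, so the longer suffix only adds a letter at position \<open>Suc i\<close>.\<close>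

lemma inner_prod_consecutive_eq_0:
  assumes i: "Suc i \<le> n" and x: "(L, c) \<in> basis_index n k (Suc i)"
    and y: "y \<in> basis_index n k i"
    and neq: "y \<noteq> (butlast L, c(Suc i := 1))" "y \<noteq> (butlast L, c(Suc i := 2))"
  shows "inner_prod n k (B i y) (B (Suc i) (L, c)) = 0"
proof (rule ccontr)
  assume nz: "inner_prod n k (B i y) (B (Suc i) (L, c)) \<noteq> 0"
  obtain L' c' where y': "y = (L', c')" by (cases y)
  note y = y[unfolded y'] and neq = neq[unfolded y'] and nz = nz[unfolded y']
  have i': "i \<le> n" using i by simp
  have len: "length L = Suc i" "length L' = i" using x y by (simp_all add: basis_index_def)
  have "L' ! m = L ! m" if "m < i" for m
    using nz chain_space_orthogonal[OF y x i', of "Suc m" "B i (L', c')" "B (Suc i) (L, c)"] that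
      basis_vector(1)[OF y i'] basis_vector(1)[OF x i] by auto
  then have "L' = butlast L" using len by (intro nth_equalityI) (simp_all add: nth_butlast)
  moreover have "c' = c(Suc i := 1) \<or> c' = c(Suc i := 2)"
  proof -
    obtain w where "B i (L', c') w \<noteq> 0" "B (Suc i) (L, c) w \<noteq> 0"
      using nz by (rule inner_prod_nonzero_support)
    then have r: "restrict w {i + 1..n} = c'" "restrict w {Suc i + 1..n} = c"
      using suffix_space_support(2) basis_vector(2)[OF y i'] basis_vector(2)[OF x i] by blast+
    \<comment> \<open>The suffix \<open>c\<close> is extensional and starts at
      \<open>Suc i + 1\<close>; updating it at \<open>Suc i\<close> prepends the letter of
      \<open>w\<close>.\<close>
    have "c' = c(Suc i := w (Suc i))"
      using i by (auto simp: fun_eq_iff restrict_def simp flip: r)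
    moreover have "c' \<in> {i + 1..n} \<rightarrow>\<^sub>E {1, 2}" using y by (simp add: basis_index_def)
    then have "c' (Suc i) \<in> {1, 2}" by (rule PiE_mem) (use i in simp)
    ultimately show ?thesis by auto
  qed
  ultimately show False using neq by auto
qed

lemma coord_Suc:
  assumes i: "1 \<le> i" "Suc i \<le> n" and f: "f \<in> fun_space n k" and x: "(L, c) \<in> basis_index n k (Suc i)"
  \<comment> \<open>A candidate that is no index contributes 0, matching the default of
    \<open>input_val\<close>, so the two-term formula needs no case distinction.\<close>
  defines "term y \<equiv> (if y \<in> basis_index n k i then coord n k B i f y else 0) *
    input_val n k B f (Matrix_Entry (Suc i) (L, c) y)"
  shows "coord n k B (Suc i) f (L, c) =
    term (butlast L, c(Suc i := 1)) + term (butlast L, c(Suc i := 2))"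
proof -
  let ?x = "(L, c)" and ?Y = "{(butlast L, c(Suc i := 1)), (butlast L, c(Suc i := 2))}"
  have i': "i \<le> n" using i by simp
  have tm: "term y = coord n k B i f y * inner_prod n k (B i y) (B (Suc i) ?x)"
    if "y \<in> basis_index n k i" for y
    using that i x coord_eq_inner_prod[OF i(2) basis_vector_in_fun_space[OF that i'] x]
    by (simp add: term_def change_entry_def)
  have "coord n k B (Suc i) f ?x =
      inner_prod n k (\<Sum>y\<in>basis_index n k i. scale (coord n k B i f y) (B i y)) (B (Suc i) ?x)"
    unfolding basis_representation[OF i' f] by (rule coord_eq_inner_prod[OF i(2) f x])
  also have "\<dots> = (\<Sum>y\<in>basis_index n k i. term y)"
    by (simp add: inner_prod_sum_left inner_prod_linear_left tm)
  also have "\<dots> = (\<Sum>y\<in>basis_index n k i \<union> ?Y. term y)"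
    by (rule sum.mono_neutral_left) (use finite_basis_index[OF i'] in \<open>auto simp: term_def\<close>)
  also have "\<dots> = (\<Sum>y\<in>?Y. term y)"
  proof (rule sum.mono_neutral_right)
    show "\<forall>y\<in>basis_index n k i \<union> ?Y - ?Y. term y = 0"
      using inner_prod_consecutive_eq_0[OF i(2) x] tm by auto
  qed (use finite_basis_index[OF i'] in auto)
  also have "\<dots> = term (butlast L, c(Suc i := 1)) + term (butlast L, c(Suc i := 2))"
    by (subst sum.insert) (auto simp: fun_eq_iff)
  finally show ?thesis .
qed

text \<open>The normalization equates two sets of vectors, so the coordinate at \<open>x\<close> is
  one at some delta function; the suffix space of \<open>x\<close> fixes the tail of its
  word.\<close>

lemma coord_1:
  assumes "x \<in> basis_index n k 1"
  obtains w where "w \<in> words n k" "restrict w {2..n} = snd x"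
    "\<forall>f. coord n k B 1 f x = coord n k B 0 f ([], w)"
proof -
  have eq: "B 1 ` basis_index n k 1 = B 0 ` basis_index n k 0"
    and delta: "\<forall>w\<in>words n k. B 0 ([], w) = delta w"
    using bases by (simp_all add: intermediate_bases_def)
  obtain w where w: "w \<in> words n k" "B 1 x = B 0 ([], w)"
    using assms eq by (auto simp: basis_index_0)
  have "B 1 x \<in> suffix_space n k 2 (snd x)"
    using basis_vector(2)[of "fst x" "snd x" 1] assms n_pos by (simp add: numeral_2_eq_2)
  moreover have "B 1 x w \<noteq> 0" using w delta by (simp add: delta_def)
  ultimately have "restrict w {2..n} = snd x"
    using suffix_space_support(2)[of "B 1 x" n k 2 "snd x" w] by blast
  moreover have "coord n k B 1 f x = coord n k B 0 f ([], w)" for f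
    using w(2) eq by (simp add: coord_def)
  ultimately show ?thesis using that w(1) by blast
qed

text \<open>At \<open>i = n\<close> the suffix is empty, which forces \<open>r = k\<close>; then
  \<open>a \<le> r\<close> and \<open>a + r \<le> n\<close> give the bound.\<close>

lemma basis_index_n:
  assumes "x \<in> basis_index n k n"
  obtains a where "a \<le> min k (n - k)" "last (fst x) = two_row n a"
  using assms n_pos unfolding basis_index_def by fastforce

text \<open>Grouping the expansion in the last basis by the final diagram gives a family meeting the
  description in \<open>component\<close>; orthogonality of the components makes it the only
  one.\<close>

lemma component_eq:
  assumes f: "f \<in> fun_space n k" and "a \<le> min k (n - k)"
  shows "component n k f a =
    (\<Sum>x\<in>{x \<in> basis_index n k n. last (fst x) = two_row n a}. scale (coord n k B n f x) (B n x))"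
proof -
  let ?s = "min k (n - k)"
  define I where "I a = {x \<in> basis_index n k n. last (fst x) = two_row n a}" for a
  define g where "g a = (if a \<le> ?s then \<Sum>x\<in>I a. scale (coord n k B n f x) (B n x) else 0)" for a
  define P where "P g \<longleftrightarrow> (\<forall>a\<le>?s. g a \<in> isotypic n k n (two_row n a)) \<and>
    (\<forall>a>?s. g a = 0) \<and> f = (\<Sum>a\<le>?s. g a)" for g
  have iso: "B n x \<in> isotypic n k n (two_row n a)" if "x \<in> I a" for x a
  proof -
    obtain L c where x: "x = (L, c)" "(L, c) \<in> basis_index n k n" "last L = two_row n a"
      using \<open>x \<in> I a\<close> by (cases x) (auto simp: I_def)
    then have "length L = n" by (simp add: basis_index_def)
    moreover have "last L = L ! (n - 1)" using \<open>length L = n\<close> n_pos by (subst last_conv_nth) auto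
    ultimately show ?thesis
      using basis_vector(1)[OF x(2)] x n_pos by (auto simp: chain_space_def)
  qed
  have "basis_index n k n = (\<Union>a\<in>{..?s}. I a)"
  proof (rule set_eqI)
    fix x
    show "x \<in> basis_index n k n \<longleftrightarrow> x \<in> (\<Union>a\<in>{..?s}. I a)"
    proof
      assume x: "x \<in> basis_index n k n"
      then obtain a where "a \<le> ?s" "last (fst x) = two_row n a" by (rule basis_index_n)
      with x show "x \<in> (\<Union>a\<in>{..?s}. I a)" unfolding I_def by blast
    qed (auto simp: I_def)
  qed
  then have "f = (\<Sum>x\<in>(\<Union>a\<in>{..?s}. I a). scale (coord n k B n f x) (B n x))"
    using basis_representation[OF order_refl f] by simp
  also have "\<dots> = (\<Sum>a\<le>?s. \<Sum>x\<in>I a. scale (coord n k B n f x) (B n x))"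
    by (rule sum.UNION_disjoint) (auto simp: I_def two_row_inject finite_basis_index)
  finally have "P g"
    using iso unfolding P_def g_def
    by (auto intro!: cvec.subspace_sum[OF isotypic_subspace] cvec.subspace_scale[OF isotypic_subspace])
  \<comment> \<open>The differences of two such families are mutually orthogonal and add up to
    \<open>f - f\<close>. Pairing the sum with one of them shows that this one has norm 0.\<close>
  moreover have "h = g" if h: "P h" for h
  proof
    fix b
    show "h b = g b"
    proof (cases "b \<le> ?s")
      case True
      have iso_diff: "h a - g a \<in> isotypic n k n (two_row n a)" if "a \<le> ?s" for a
        using that h \<open>P g\<close> by (auto simp: P_def intro: cvec.subspace_diff[OF isotypic_subspace])
      have "inner_prod n k (h a - g a) (h b - g b) = 0" if "a \<le> ?s" "a \<noteq> b" for a
        by (rule isotypic_orthogonal[OF that(2) _ _ order_refl iso_diff iso_diff])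
          (use that True k_le in auto)
      then have "inner_prod n k (h b - g b) (h b - g b) =
          (\<Sum>a\<le>?s. inner_prod n k (h a - g a) (h b - g b))"
        using True by (subst sum.remove[of _ b]) auto
      also have "\<dots> = inner_prod n k ((\<Sum>a\<le>?s. h a) - (\<Sum>a\<le>?s. g a)) (h b - g b)"
        by (simp add: inner_prod_sum_left flip: sum_subtractf)
      also have "\<dots> = inner_prod n k (f - f) (h b - g b)"
        using h \<open>P g\<close> unfolding P_def by metis
      also have "\<dots> = 0" unfolding diff_self by (rule inner_prod_linear_left)
      finally have "inner_prod n k (h b - g b) (h b - g b) = 0" .
      then have "h b - g b = 0"
        using iso_diff[OF True] isotypic_subset_fun_space inner_prod_self_eq_0 by blast
      then show ?thesis by simp
    next
      case False
      then have "b > ?s" by (simp only: not_le)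
      then show ?thesis using h \<open>P g\<close> unfolding P_def by metis
    qed
  qed
  ultimately have "(THE g. P g) = g" by (rule the_equality)
  then show ?thesis using assms(2) by (simp add: component_def P_def g_def I_def)
qed

text \<open>Parseval's identity on the part of the orthonormal basis lying in the component.\<close>

lemma weight_eq:
  assumes f: "f \<in> fun_space n k" and a: "a \<le> min k (n - k)"
  shows "complex_of_real ((vec_norm n k (component n k f a))\<^sup>2) =
    (\<Sum>x\<in>{x \<in> basis_index n k n. last (fst x) = two_row n a}.
      coord n k B n f x * cnj (coord n k B n f x))"
proof -
  let ?I = "{x \<in> basis_index n k n. last (fst x) = two_row n a}" and ?c = "coord n k B n f"
  have fin: "finite ?I" using finite_basis_index by simp
  have "complex_of_real ((vec_norm n k (component n k f a))\<^sup>2) =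
      (\<Sum>x\<in>?I. \<Sum>y\<in>?I. cnj (?c x) * (?c y * inner_prod n k (B n y) (B n x)))"
    unfolding inner_prod_self[symmetric] component_eq[OF f a]
    by (simp add: inner_prod_sum_left inner_prod_sum_right inner_prod_linear_left
        inner_prod_linear_right sum_distrib_left)
  also have "\<dots> = (\<Sum>x\<in>?I. \<Sum>y\<in>?I. if y = x then cnj (?c x) * ?c y else 0)"
    by (intro sum.cong) (auto simp: basis_orthonormal)
  also have "\<dots> = (\<Sum>x\<in>?I. ?c x * cnj (?c x))"
    using fin by (intro sum.cong) (simp_all add: mult.commute)
  finally show ?thesis .
qed

end

section \<open>Operation counts\<close>

lemma exec_append: "exec env rs (P @ Q) = exec env (exec env rs P) Q"
  by (induction env rs P rule: exec.induct) auto

text \<open>One program must serve all parameters \<open>p\<close>, so the intermediate values are functions of \<open>p\<close>. The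
  suffix \<open>rs\<close> ensures that operands keep their values when the program is continued; it excludes
  \<open>Result j\<close> with \<open>j\<close> out of range, which reads as 0.\<close>

definition computable :: "('p \<Rightarrow> 'v \<Rightarrow> complex) \<Rightarrow> 'p set \<Rightarrow> nat \<Rightarrow> ('p \<Rightarrow> complex) set \<Rightarrow> bool" where
  "computable env S m F \<longleftrightarrow> (\<exists>P. length P \<le> m \<and>
     (\<forall>g\<in>F. \<exists>x. \<forall>p\<in>S. \<forall>rs. operand_val (env p) (exec (env p) [] P @ rs) x = g p))"

lemma computable_mono: "computable env S m F \<Longrightarrow> G \<subseteq> F \<Longrightarrow> m \<le> m' \<Longrightarrow> computable env S m' G"
  unfolding computable_def by (blast intro: order_trans)

lemma computable_input:
  "computable env S 0 ({\<lambda>p. 0} \<union> range (\<lambda>v p. env p v))"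
proof -
  have "\<exists>x. \<forall>p\<in>S. \<forall>rs. operand_val (env p) (exec (env p) [] [] @ rs) x = g p"
    if g: "g \<in> {\<lambda>p. 0} \<union> range (\<lambda>v p. env p v)" for g
  proof (cases "g = (\<lambda>p. 0)")
    case True
    then show ?thesis by (intro exI[of _ Zero]) simp
  next
    case False
    then obtain v where "g = (\<lambda>p. env p v)" using g by auto
    then show ?thesis by (intro exI[of _ "Input v"]) simp
  qed
  then show ?thesis unfolding computable_def by (intro exI[of _ "[]"]) simp
qed

text \<open>Agreement is asked only on \<open>S\<close>, so mathematical identities valid for
  admissible data enter at no cost.\<close>

lemma computable_cong:
  assumes "computable env S m F" "g \<in> F" "\<And>p. p \<in> S \<Longrightarrow> h p = g p"
  shows "computable env S m (insert h F)"
proof -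
  obtain P where P: "length P \<le> m"
    "\<forall>g\<in>F. \<exists>x. \<forall>p\<in>S. \<forall>rs. operand_val (env p) (exec (env p) [] P @ rs) x = g p"
    using assms(1) unfolding computable_def by blast
  moreover from this obtain x where
    "\<forall>p\<in>S. \<forall>rs. operand_val (env p) (exec (env p) [] P @ rs) x = g p" using assms(2) by blast
  then have "\<forall>p\<in>S. \<forall>rs. operand_val (env p) (exec (env p) [] P @ rs) x = h p"
    using assms(3) by simp
  ultimately show ?thesis unfolding computable_def by (intro exI[of _ P]) auto
qed

text \<open>Conjugation is part of the operand, so no instruction is added.\<close>

lemma computable_cnj:
  assumes "computable env S m F" "g \<in> F"
  shows "computable env S m (insert (\<lambda>p. cnj (g p)) F)"
proof -
  obtain P where P: "length P \<le> m"
    "\<forall>g\<in>F. \<exists>x. \<forall>p\<in>S. \<forall>rs. operand_val (env p) (exec (env p) [] P @ rs) x = g p"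
    using assms(1) unfolding computable_def by blast
  moreover from this obtain x where
    "\<forall>p\<in>S. \<forall>rs. operand_val (env p) (exec (env p) [] P @ rs) x = g p" using assms(2) by blast
  then have "\<forall>p\<in>S. \<forall>rs. operand_val (env p) (exec (env p) [] P @ rs) (Conj x) = cnj (g p)"
    by simp
  ultimately show ?thesis unfolding computable_def by blast
qed

lemma computable_step:
  assumes "computable env S m F" "g \<in> F" "g1 \<in> F" "g2 \<in> F"
  shows "computable env S (Suc m) (insert (\<lambda>p. g p + g1 p * g2 p) F)"
proof -
  obtain P where P: "length P \<le> m"
    "\<forall>g\<in>F. \<exists>x. \<forall>p\<in>S. \<forall>rs. operand_val (env p) (exec (env p) [] P @ rs) x = g p"
    using assms(1) unfolding computable_def by blast
  obtain x where x: "\<forall>p\<in>S. \<forall>rs. operand_val (env p) (exec (env p) [] P @ rs) x = g p"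
    using P(2) assms(2) by blast
  obtain y where y: "\<forall>p\<in>S. \<forall>rs. operand_val (env p) (exec (env p) [] P @ rs) y = g1 p"
    using P(2) assms(3) by blast
  obtain z where z: "\<forall>p\<in>S. \<forall>rs. operand_val (env p) (exec (env p) [] P @ rs) z = g2 p"
    using P(2) assms(4) by blast
  let ?P = "P @ [(x, y, z)]"
  have len: "length (exec e rs Q) = length rs + length Q" for e rs and Q :: "'b program"
    by (induction e rs Q rule: exec.induct) auto
  have ex: "exec (env p) [] ?P = exec (env p) [] P @ [g p + g1 p * g2 p]" if "p \<in> S" for p
    using x[rule_format, OF that, of "[]"] y[rule_format, OF that, of "[]"]
      z[rule_format, OF that, of "[]"] by (simp add: exec_append)
  have "\<exists>x. \<forall>p\<in>S. \<forall>rs. operand_val (env p) (exec (env p) [] ?P @ rs) x = h p"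
    if "h \<in> insert (\<lambda>p. g p + g1 p * g2 p) F" for h
  proof (cases "h \<in> F")
    case True
    then obtain u where "\<forall>p\<in>S. \<forall>rs. operand_val (env p) (exec (env p) [] P @ rs) u = h p"
      using P(2) by blast
    then show ?thesis by (intro exI[of _ u]) (simp add: ex)
  next
    case False
    with that have h: "h = (\<lambda>p. g p + g1 p * g2 p)" by simp
    show ?thesis
      \<comment> \<open>Results are numbered from 0, so the appended instruction is stored at
        \<open>length P\<close>.\<close>
      by (intro exI[of _ "Result (length P)"]) (simp add: ex h nth_append len)
  qed
  moreover have "length ?P \<le> Suc m" using P(1) by simp
  ultimately show ?thesis unfolding computable_def by blast
qed

text \<open>The step is required for every larger stock \<open>G\<close> and every count, because
  earlier members stay available while the costs add up.\<close>

lemma computable_family: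
  assumes "computable env S m F" "finite X"
    and step: "\<And>x m G. x \<in> X \<Longrightarrow> F \<subseteq> G \<Longrightarrow> computable env S m G \<Longrightarrow>
      computable env S (m + q x) (insert (h x) G)"
  shows "computable env S (m + (\<Sum>x\<in>X. q x)) (F \<union> h ` X)"
  using assms(2,3)
proof (induction X)
  case empty
  then show ?case using assms(1) by simp
next
  case (insert x X)
  have "computable env S (m + (\<Sum>x\<in>X. q x)) (F \<union> h ` X)"
    using insert.prems by (intro insert.IH) blast
  then have "computable env S (m + (\<Sum>x\<in>X. q x) + q x) (insert (h x) (F \<union> h ` X))"
    by (intro insert.prems) auto
  then show ?case using insert.hyps by (simp add: algebra_simps)
qed

text \<open>The running sum starts from the constant 0, and each term is one multiply-and-add with a
  free conjugation.\<close>

lemma computable_sum_squares: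
  assumes "computable env S m F" "finite X" "(\<lambda>p. 0) \<in> F" "\<And>x. x \<in> X \<Longrightarrow> g x \<in> F"
  shows "computable env S (m + card X) (insert (\<lambda>p. \<Sum>x\<in>X. g x p * cnj (g x p)) F)"
  using assms(2,4)
proof (induction X)
  case empty
  then show ?case using assms(1,3) by (simp add: insert_absorb)
next
  case (insert x X)
  let ?s = "\<lambda>p. \<Sum>x\<in>X. g x p * cnj (g x p)"
  have "computable env S (m + card X) (insert ?s F)"
    using insert.prems by (intro insert.IH) blast
  then have "computable env S (m + card X) (insert (\<lambda>p. cnj (g x p)) (insert ?s F))"
    by (rule computable_cnj) (use insert.prems in blast)
  then have "computable env S (Suc (m + card X))
      (insert (\<lambda>p. ?s p + g x p * cnj (g x p)) (insert (\<lambda>p. cnj (g x p)) (insert ?s F)))"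
    by (rule computable_step) (use insert.prems in auto)
  moreover have "(\<lambda>p. ?s p + g x p * cnj (g x p)) =
      (\<lambda>p. \<Sum>x\<in>insert x X. g x p * cnj (g x p))"
    using insert.hyps by (simp add: add.commute)
  ultimately show ?case
    using insert.hyps by (elim computable_mono) auto
qed

section \<open>Costs of the coordinates in successive bases and of the weights\<close>

definition instances :: "nat \<Rightarrow> nat \<Rightarrow> ((nat \<Rightarrow> index \<Rightarrow> vec) \<times> vec) set" where
  "instances n k = {(B, f). intermediate_bases n k B \<and> f \<in> fun_space n k}"

definition input_fun :: "nat \<Rightarrow> nat \<Rightarrow> (nat \<Rightarrow> index \<Rightarrow> vec) \<times> vec \<Rightarrow> input_name \<Rightarrow> complex" where
  "input_fun n k p = input_val n k (fst p) (snd p)"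

definition coord_fun :: "nat \<Rightarrow> nat \<Rightarrow> nat \<Rightarrow> index \<Rightarrow> (nat \<Rightarrow> index \<Rightarrow> vec) \<times> vec \<Rightarrow> complex" where
  "coord_fun n k i x p = coord n k (fst p) i (snd p) x"

definition input_funs :: "nat \<Rightarrow> nat \<Rightarrow> ((nat \<Rightarrow> index \<Rightarrow> vec) \<times> vec \<Rightarrow> complex) set" where
  "input_funs n k = {\<lambda>p. 0} \<union> range (\<lambda>v p. input_fun n k p v)"

context basis_family
begin

lemma instance_basis_family:
  assumes "p \<in> instances n k"
  shows "basis_family n k (fst p)" "snd p \<in> fun_space n k"
  using assms n_pos k_le by (auto simp: instances_def basis_family_def)

text \<open>Coordinates in the basis for \<open>i = 1\<close> are input coordinates in another
  order, hence cost nothing.\<close>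

lemma computable_coord_1:
  "computable (input_fun n k) (instances n k) 0
    (input_funs n k \<union> coord_fun n k 1 ` basis_index n k 1)"
proof -
  have F: "computable (input_fun n k) (instances n k) 0 (input_funs n k)"
    unfolding input_funs_def by (rule computable_input)
  have "computable (input_fun n k) (instances n k) (0 + (\<Sum>x\<in>basis_index n k 1. 0))
    (input_funs n k \<union> coord_fun n k 1 ` basis_index n k 1)"
  proof (rule computable_family[OF F])
    fix x m G
    assume x: "x \<in> basis_index n k 1"
      and G: "input_funs n k \<subseteq> G" "computable (input_fun n k) (instances n k) m G"
    obtain w where w: "w \<in> words n k" "restrict w {2..n} = snd x"
      using coord_1[OF x] .
    have eq: "coord_fun n k 1 x p = input_fun n k p (Vector_Entry ([], w))"
      if p: "p \<in> instances n k" for p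
    proof -
      obtain w' where w': "w' \<in> words n k" "restrict w' {2..n} = snd x"
        "\<forall>f. coord n k (fst p) 1 f x = coord n k (fst p) 0 f ([], w')"
        using basis_family.coord_1[OF instance_basis_family(1)[OF p] x] .
      \<comment> \<open>The word obtained from another choice of bases has the same tail, hence is
        the same word. One input name therefore serves all instances.\<close>
      have "w' = w" using words_eqI[OF w'(1) w(1)] w(2) w'(2) by metis
      then show ?thesis
        using w'(3)[rule_format, of "snd p"] w(1)
        by (simp add: coord_fun_def input_fun_def basis_index_0)
    qed
    have "(\<lambda>p. input_fun n k p (Vector_Entry ([], w))) \<in> G"
      using G(1) by (auto simp: input_funs_def)
    then show "computable (input_fun n k) (instances n k) (m + 0) (insert (coord_fun n k 1 x) G)"
      using computable_cong[OF G(2) _ eq] by simp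
  qed (use finite_basis_index n_pos in simp)
  then show ?thesis by simp
qed

lemma computable_coord_Suc:
  assumes i: "1 \<le> i" "Suc i \<le> n" and x: "x \<in> basis_index n k (Suc i)"
    and F: "input_funs n k \<union> coord_fun n k i ` basis_index n k i \<subseteq> G"
    and G: "computable (input_fun n k) (instances n k) m G"
  shows "computable (input_fun n k) (instances n k) (m + 2) (insert (coord_fun n k (Suc i) x) G)"
proof -
  obtain L c where Lc: "x = (L, c)" by (cases x)
  define V where "V y p = (if y \<in> basis_index n k i then coord_fun n k i y p else 0)" for y p
  define M where "M y p = input_fun n k p (Matrix_Entry (Suc i) x y)" for y p
  let ?y1 = "(butlast L, c(Suc i := 1))" and ?y2 = "(butlast L, c(Suc i := 2))"
  have zero: "(\<lambda>p. 0) \<in> G" using F by (auto simp: input_funs_def)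
  have V: "V y \<in> G" for y
  proof (cases "y \<in> basis_index n k i")
    case True
    then have "V y = coord_fun n k i y" by (simp add: V_def fun_eq_iff)
    then show ?thesis using True F by auto
  next
    case False
    then have "V y = (\<lambda>p. 0)" by (simp add: V_def fun_eq_iff)
    then show ?thesis using zero by simp
  qed
  have M: "M y \<in> G" for y
    using F unfolding M_def input_funs_def by blast
  let ?t = "\<lambda>p. 0 + V ?y1 p * M ?y1 p"
  have "computable (input_fun n k) (instances n k) (Suc m) (insert ?t G)"
    by (rule computable_step[OF G zero V M])
  then have 2: "computable (input_fun n k) (instances n k) (Suc (Suc m))
      (insert (\<lambda>p. ?t p + V ?y2 p * M ?y2 p) (insert ?t G))"
    by (rule computable_step) (use V M in blast)+
  have eq: "coord_fun n k (Suc i) x p = ?t p + V ?y2 p * M ?y2 p" if "p \<in> instances n k" for p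
    using basis_family.coord_Suc[OF instance_basis_family(1)[OF that] i
        instance_basis_family(2)[OF that] x[unfolded Lc]]
    by (simp only: coord_fun_def V_def M_def input_fun_def Lc add_0)
  have "computable (input_fun n k) (instances n k) (Suc (Suc m)) (insert (coord_fun n k (Suc i) x)
      (insert (\<lambda>p. ?t p + V ?y2 p * M ?y2 p) (insert ?t G)))"
    by (rule computable_cong[OF 2 insertI1 eq])
  then show ?thesis by (rule computable_mono) auto
qed

text \<open>The basis for \<open>i = 1\<close> is free, and each of the \<open>i - 1\<close>
  passages spends two operations on each of \<open>n choose k\<close> coordinates.\<close>

lemma computable_coord:
  assumes "1 \<le> i" "i \<le> n"
  shows "computable (input_fun n k) (instances n k) (2 * (i - 1) * (n choose k))
    (input_funs n k \<union> coord_fun n k i ` basis_index n k i)"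
  using assms
proof (induction i rule: dec_induct)
  case base
  show ?case using computable_coord_1 by simp
next
  case (step i)
  then have i: "1 \<le> i" "Suc i \<le> n" by simp_all
  let ?F = "input_funs n k \<union> coord_fun n k i ` basis_index n k i"
  have IH: "computable (input_fun n k) (instances n k) (2 * (i - 1) * (n choose k)) ?F"
    using step by simp
  have "computable (input_fun n k) (instances n k)
      (2 * (i - 1) * (n choose k) + (\<Sum>x\<in>basis_index n k (Suc i). 2))
      (?F \<union> coord_fun n k (Suc i) ` basis_index n k (Suc i))"
    by (rule computable_family[OF IH finite_basis_index[OF i(2)]]) (rule computable_coord_Suc[OF i])
  moreover have "2 * (i - 1) * (n choose k) + (\<Sum>x\<in>basis_index n k (Suc i). 2) =
      2 * (Suc i - 1) * (n choose k)"
    using i by (cases i) (simp_all add: card_basis_index algebra_simps)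
  ultimately show ?case by (elim computable_mono) auto
qed

text \<open>Index sets for different \<open>a\<close> are disjoint, so all weights together cost at
  most \<open>n choose k\<close> beyond the passages.\<close>

lemma computable_weights:
  "computable (input_fun n k) (instances n k) ((2 * n - 1) * (n choose k))
    ((\<lambda>a p. complex_of_real ((vec_norm n k (component n k (snd p) a))\<^sup>2)) ` {..min k (n - k)})"
proof -
  let ?s = "min k (n - k)" and ?N = "n choose k"
  define I where "I a = {x \<in> basis_index n k n. last (fst x) = two_row n a}" for a
  define W where "W a p = (\<Sum>x\<in>I a. coord_fun n k n x p * cnj (coord_fun n k n x p))" for a p
  define weight where
    "weight a p = complex_of_real ((vec_norm n k (component n k (snd p) a))\<^sup>2)"
    for a and p :: "(nat \<Rightarrow> index \<Rightarrow> vec) \<times> vec"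
  let ?F = "input_funs n k \<union> coord_fun n k n ` basis_index n k n"
  have fin: "finite (I a)" for a using finite_basis_index by (simp add: I_def)
  have "computable (input_fun n k) (instances n k)
      (2 * (n - 1) * ?N + (\<Sum>a\<le>?s. card (I a))) (?F \<union> weight ` {..?s})"
  proof (rule computable_family[OF computable_coord[OF n_pos order_refl]])
    fix a m G
    assume a: "a \<in> {..?s}"
      and G: "?F \<subseteq> G" "computable (input_fun n k) (instances n k) m G"
    have W: "computable (input_fun n k) (instances n k) (m + card (I a)) (insert (W a) G)"
      unfolding W_def
      by (rule computable_sum_squares[OF G(2) fin])
        (use G(1) in \<open>auto simp: I_def input_funs_def\<close>)
    have eq: "weight a p = W a p" if "p \<in> instances n k" for p
      using basis_family.weight_eq[OF instance_basis_family[OF that]] a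
      by (simp add: weight_def W_def coord_fun_def I_def)
    have "computable (input_fun n k) (instances n k) (m + card (I a))
        (insert (weight a) (insert (W a) G))"
      by (rule computable_cong[OF W insertI1 eq])
    then show "computable (input_fun n k) (instances n k) (m + card (I a)) (insert (weight a) G)"
      by (rule computable_mono) auto
  qed simp
  moreover have "(\<Sum>a\<le>?s. card (I a)) \<le> ?N"
  proof -
    have "(\<Sum>a\<le>?s. card (I a)) = card (\<Union>a\<in>{..?s}. I a)"
      by (rule card_UN_disjoint[symmetric]) (use fin in \<open>auto simp: I_def two_row_inject\<close>)
    also have "\<dots> \<le> card (basis_index n k n)"
      by (rule card_mono) (auto simp: I_def finite_basis_index)
    finally show ?thesis by (simp add: card_basis_index)
  qed
  moreover have "2 * (n - 1) * ?N + ?N = (2 * n - 1) * ?N"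
    using n_pos by (cases n) (simp_all add: algebra_simps)
  ultimately have "computable (input_fun n k) (instances n k) ((2 * n - 1) * ?N) (weight ` {..?s})"
    by (elim computable_mono) auto
  then show ?thesis by (simp only: weight_def[abs_def])
qed

end

text \<open>An output operand is chosen for each \<open>a\<close> before any instance is given; the
  empty continuation \<open>rs\<close> yields the final values.\<close>

lemma computable_program:
  assumes "computable env S m (g ` A)"
  obtains P out where "operations P \<le> m"
    "\<And>a p. a \<in> A \<Longrightarrow> p \<in> S \<Longrightarrow> result (env p) P (out a) = g a p"
proof -
  obtain P where P: "length P \<le> m"
    "\<forall>h\<in>g ` A. \<exists>x. \<forall>p\<in>S. \<forall>rs. operand_val (env p) (exec (env p) [] P @ rs) x = h p"
    using assms unfolding computable_def by blast
  define out where
    "out a = (SOME x. \<forall>p\<in>S. \<forall>rs. operand_val (env p) (exec (env p) [] P @ rs) x = g a p)" for a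
  have "result (env p) P (out a) = g a p" if "a \<in> A" "p \<in> S" for a p
  proof -
    have "\<exists>x. \<forall>p\<in>S. \<forall>rs. operand_val (env p) (exec (env p) [] P @ rs) x = g a p"
      using P(2) that(1) by blast
    then have "\<forall>p\<in>S. \<forall>rs. operand_val (env p) (exec (env p) [] P @ rs) (out a) = g a p"
      unfolding out_def by (rule someI_ex)
    then have "operand_val (env p) (exec (env p) [] P @ []) (out a) = g a p"
      using that(2) by blast
    then show ?thesis by (simp add: result_def)
  qed
  then show ?thesis using P(1) that[of P out] by (simp add: operations_def)
qed

theorem theorem9:
  fixes n k :: nat
  assumes "1 \<le> n" and "k \<le> n"
  shows "\<exists>(P :: input_name program) (out :: nat \<Rightarrow> input_name operand).
    operations P \<le> (2 * n - 1) * (n choose k) \<and>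
    (\<forall>B f. intermediate_bases n k B \<longrightarrow> f \<in> fun_space n k \<longrightarrow>
      (\<forall>a\<le>min k (n - k).
        result (input_val n k B f) P (out a)
          = complex_of_real ((vec_norm n k (component n k f a))\<^sup>2)))"
proof (cases "\<exists>B. intermediate_bases n k B")
  \<comment> \<open>Without admissible bases the requirement on the results is vacuous and the empty
    program suffices.\<close>
  case False
  then show ?thesis by (intro exI[of _ "[]"]) (simp add: operations_def)
next
  case True
  then obtain B where "intermediate_bases n k B" by blast
  then have "basis_family n k B" using assms by (simp add: basis_family_def)
  \<comment> \<open>The chosen \<open>B\<close> only serves to enter the locale; the resulting
    program is correct on all of \<open>instances n k\<close>.\<close>
  then obtain P out where P: "operations P \<le> (2 * n - 1) * (n choose k)"
    "\<And>a p. a \<in> {..min k (n - k)} \<Longrightarrow> p \<in> instances n k \<Longrightarrow>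
      result (input_fun n k p) P (out a) =
        complex_of_real ((vec_norm n k (component n k (snd p) a))\<^sup>2)"
    by (rule computable_program[OF basis_family.computable_weights]) blast
  have "result (input_val n k B f) P (out a) =
      complex_of_real ((vec_norm n k (component n k f a))\<^sup>2)"
    if "intermediate_bases n k B" "f \<in> fun_space n k" "a \<le> min k (n - k)" for B f a
    using P(2)[of a "(B, f)"] that by (simp add: instances_def input_fun_def)
  then show ?thesis using P(1) by (intro exI[of _ P] exI[of _ out]) simp
qed

end
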